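(* Let $(\mathcal{A}, \mathcal{E})$ be an exact category with enough projective and enough injective objects, and let $\mathcal{P}$ and $\mathcal{I}$ be the full subcategories of $\mathcal{A}$ consisting of projective and injective objects, respectively. Assume that $\mathcal{P}'\subseteq \mathcal{P}$ and $\mathcal{I}'\subseteq \mathcal{I}$ are two full additive subcategories subject to the following conditions: (1) $\mathcal{P}'\vee \mathcal{I}=\mathcal{I}'\vee \mathcal{P}$; (2) $\mathcal{P}'\subseteq \mathcal{A}$ is covariantly finite and $\mathcal{I}'\subseteq \mathcal{A}$ is contravariantly finite; (3) the class of right $\mathcal{I}'$-acyclic conflations (in $\mathcal{E}$) coincides with the class of left $\mathcal{P}'$-acyclic conflations (in $\mathcal{E}$). Denote the class of conflations in (3) by $\mathcal{E}'$. Then the pair $(\mathcal{A}, \mathcal{E}')$ is a Frobenius exact category.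
   Context: Exact categories are in the sense of Quillen: $\mathcal{E}$ is the class of conflations $X\xrightarrow{i}Y\xrightarrow{d}Z$, where $i$ is called an inflation and $d$ a deflation. An object $P$ is projective if $\operatorname{Hom}_\mathcal{A}(P,-)$ sends conflations to short exact sequences; there are enough projective objects if each object $X$ admits a deflation $P\to X$ with $P$ projective; injective objects and having enough injective objects are defined dually. An exact category is Frobenius if it has enough projective and enough injective objects and the class of projective objects coincides with the class of injective objects. For full subcategories $\mathcal{X},\mathcal{Y}$ of $\mathcal{A}$, $\mathcal{X}\vee\mathcal{Y}$ denotes the smallest full additive subcategory of $\mathcal{A}$ that contains $\mathcal{X}$ and $\mathcal{Y}$ and is closed under taking direct summands. A full additive subcategory $\mathcal{S}\subseteq\mathcal{A}$ is contravariantly finite if each object $X$ of $\mathcal{A}$ has a right $\mathcal{S}$-approximation, i.e. a morphism $S\to X$ with $S\in\mathcal{S}$ through which every morphism from an object of $\mathcal{S}$ to $X$ factors. Dually, $\mathcal{S}$ is covariantly finite if each object $X$ has a left $\mathcal{S}$-approximation, i.e. a morphism $X\to S$ with $S\in\mathcal{S}$ through which every morphism from $X$ to an object of $\mathcal{S}$ factors. A conflation $\eta\colon X\to Y\to Z$ is right $\mathcal{S}$-acyclic if the sequence $\operatorname{Hom}_\mathcal{A}(S,\eta)$ is short exact for all $S\in\mathcal{S}$, and left $\mathcal{S}$-acyclic if the sequence $\operatorname{Hom}_\mathcal{A}(\eta,S)$ is short exact for all $S\in\mathcal{S}$. *)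

theory Defs
  imports "HOL-Algebra.Exact_Sequence"
begin

section \<open>Additive categories\<close>

text \<open>A small category with an addition on its morphisms. \<open>g \<bullet> f\<close> is the composite
  ``\<open>g\<close> after \<open>f\<close>'', and \<open>Zero C X Y\<close> is the zero morphism from \<open>X\<close> to \<open>Y\<close>.\<close>

record ('o, 'm) precategory =
  Ob :: "'o set"
  Arr :: "'m set"
  Src :: "'m \<Rightarrow> 'o"
  Tgt :: "'m \<Rightarrow> 'o"
  Ide :: "'o \<Rightarrow> 'm"
  Cmp :: "'m \<Rightarrow> 'm \<Rightarrow> 'm" (infixl \<open>\<bullet>\<index>\<close> 70)
  Plus :: "'m \<Rightarrow> 'm \<Rightarrow> 'm" (infixl \<open>\<^bold>+\<index>\<close> 65)
  Zero :: "'o \<Rightarrow> 'o \<Rightarrow> 'm"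

definition Hom :: "('o, 'm, 'z) precategory_scheme \<Rightarrow> 'o \<Rightarrow> 'o \<Rightarrow> 'm set" where
  "Hom C X Y = {f \<in> Arr C. Src C f = X \<and> Tgt C f = Y}"

text \<open>The abelian group of morphisms from \<open>X\<close> to \<open>Y\<close>; HOL-Algebra's multiplicative
  record is used because exact sequences of groups are defined for it.\<close>

definition Hom_group :: "('o, 'm, 'z) precategory_scheme \<Rightarrow> 'o \<Rightarrow> 'o \<Rightarrow> 'm monoid" where
  "Hom_group C X Y = \<lparr>carrier = Hom C X Y, mult = Plus C, one = Zero C X Y\<rparr>"

locale category =
  fixes C :: "('o, 'm, 'z) precategory_scheme" (structure)
  assumes Src_Ob: "f \<in> Arr C \<Longrightarrow> Src C f \<in> Ob C"
    and Tgt_Ob: "f \<in> Arr C \<Longrightarrow> Tgt C f \<in> Ob C"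
    and Ide_Hom: "X \<in> Ob C \<Longrightarrow> Ide C X \<in> Hom C X X"
    and Cmp_Hom: "\<lbrakk>f \<in> Hom C X Y; g \<in> Hom C Y Z\<rbrakk> \<Longrightarrow> g \<bullet> f \<in> Hom C X Z"
    and Cmp_Ide: "f \<in> Hom C X Y \<Longrightarrow> f \<bullet> Ide C X = f"
    and Ide_Cmp: "f \<in> Hom C X Y \<Longrightarrow> Ide C Y \<bullet> f = f"
    and Cmp_assoc:
      "\<lbrakk>f \<in> Hom C W X; g \<in> Hom C X Y; h \<in> Hom C Y Z\<rbrakk> \<Longrightarrow> h \<bullet> (g \<bullet> f) = (h \<bullet> g) \<bullet> f"

locale preadditive_category = category +
  assumes Hom_comm_group: "\<lbrakk>X \<in> Ob C; Y \<in> Ob C\<rbrakk> \<Longrightarrow> comm_group (Hom_group C X Y)"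
    and Cmp_Plus_right: "\<lbrakk>f \<in> Hom C X Y; f' \<in> Hom C X Y; g \<in> Hom C Y Z\<rbrakk>
      \<Longrightarrow> g \<bullet> (f \<^bold>+ f') = (g \<bullet> f) \<^bold>+ (g \<bullet> f')"
    and Cmp_Plus_left: "\<lbrakk>f \<in> Hom C X Y; g \<in> Hom C Y Z; g' \<in> Hom C Y Z\<rbrakk>
      \<Longrightarrow> (g \<^bold>+ g') \<bullet> f = (g \<bullet> f) \<^bold>+ (g' \<bullet> f)"

definition zero_object :: "('o, 'm, 'z) precategory_scheme \<Rightarrow> 'o \<Rightarrow> bool" where
  "zero_object C Z \<longleftrightarrow>
     Z \<in> Ob C \<and> (\<forall>X\<in>Ob C. (\<exists>!f. f \<in> Hom C X Z) \<and> (\<exists>!f. f \<in> Hom C Z X))"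

definition direct_sum :: "('o, 'm, 'z) precategory_scheme \<Rightarrow> 'o \<Rightarrow> 'o \<Rightarrow> 'o \<Rightarrow> bool" where
  "direct_sum C X Y S \<longleftrightarrow> X \<in> Ob C \<and> Y \<in> Ob C \<and> S \<in> Ob C \<and>
     (\<exists>i\<in>Hom C X S. \<exists>j\<in>Hom C Y S. \<exists>p\<in>Hom C S X. \<exists>q\<in>Hom C S Y.
        p \<bullet>\<^bsub>C\<^esub> i = Ide C X \<and> q \<bullet>\<^bsub>C\<^esub> j = Ide C Y \<and>
        p \<bullet>\<^bsub>C\<^esub> j = Zero C Y X \<and> q \<bullet>\<^bsub>C\<^esub> i = Zero C X Y \<and>
        (i \<bullet>\<^bsub>C\<^esub> p) \<^bold>+\<^bsub>C\<^esub> (j \<bullet>\<^bsub>C\<^esub> q) = Ide C S)"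

locale additive_category = preadditive_category +
  assumes ex_zero_object: "\<exists>Z. zero_object C Z"
    and ex_direct_sum: "\<lbrakk>X \<in> Ob C; Y \<in> Ob C\<rbrakk> \<Longrightarrow> \<exists>S. direct_sum C X Y S"

section \<open>Full additive subcategories and approximations\<close>

text \<open>A full subcategory is given by its set of objects. It is not required to be closed under
  isomorphisms: it only has to contain some zero object and some direct sum of any two of its
  objects, which says precisely that the full subcategory is itself additive.\<close>

definition additive_subcategory :: "('o, 'm, 'z) precategory_scheme \<Rightarrow> 'o set \<Rightarrow> bool" where
  "additive_subcategory C \<S> \<longleftrightarrow> \<S> \<subseteq> Ob C \<and> (\<exists>Z\<in>\<S>. zero_object C Z) \<and>
     (\<forall>X\<in>\<S>. \<forall>Y\<in>\<S>. \<exists>S\<in>\<S>. direct_sum C X Y S)"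

definition summand_closed :: "('o, 'm, 'z) precategory_scheme \<Rightarrow> 'o set \<Rightarrow> bool" where
  "summand_closed C \<S> \<longleftrightarrow> (\<forall>X Y S. direct_sum C X Y S \<and> S \<in> \<S> \<longrightarrow> X \<in> \<S>)"

text \<open>\<open>\<X> \<or> \<Y>\<close>: closure under direct summands entails closure under isomorphisms, so the
  intersection is again an additive subcategory, hence the smallest one with these properties.\<close>

definition subcategory_join ::
    "('o, 'm, 'z) precategory_scheme \<Rightarrow> 'o set \<Rightarrow> 'o set \<Rightarrow> 'o set" where
  "subcategory_join C \<X> \<Y> =
     \<Inter> {\<S>. additive_subcategory C \<S> \<and> summand_closed C \<S> \<and> \<X> \<subseteq> \<S> \<and> \<Y> \<subseteq> \<S>}"

definition right_approximation ::
    "('o, 'm, 'z) precategory_scheme \<Rightarrow> 'o set \<Rightarrow> 'o \<Rightarrow> 'm \<Rightarrow> bool" where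
  "right_approximation C \<S> X f \<longleftrightarrow> (\<exists>S\<in>\<S>. f \<in> Hom C S X) \<and>
     (\<forall>T\<in>\<S>. \<forall>g\<in>Hom C T X. \<exists>h\<in>Hom C T (Src C f). g = f \<bullet>\<^bsub>C\<^esub> h)"

definition left_approximation ::
    "('o, 'm, 'z) precategory_scheme \<Rightarrow> 'o set \<Rightarrow> 'o \<Rightarrow> 'm \<Rightarrow> bool" where
  "left_approximation C \<S> X f \<longleftrightarrow> (\<exists>S\<in>\<S>. f \<in> Hom C X S) \<and>
     (\<forall>T\<in>\<S>. \<forall>g\<in>Hom C X T. \<exists>h\<in>Hom C (Tgt C f) T. g = h \<bullet>\<^bsub>C\<^esub> f)"

definition contravariantly_finite :: "('o, 'm, 'z) precategory_scheme \<Rightarrow> 'o set \<Rightarrow> bool" where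
  "contravariantly_finite C \<S> \<longleftrightarrow>
     additive_subcategory C \<S> \<and> (\<forall>X\<in>Ob C. \<exists>f. right_approximation C \<S> X f)"

definition covariantly_finite :: "('o, 'm, 'z) precategory_scheme \<Rightarrow> 'o set \<Rightarrow> bool" where
  "covariantly_finite C \<S> \<longleftrightarrow>
     additive_subcategory C \<S> \<and> (\<forall>X\<in>Ob C. \<exists>f. left_approximation C \<S> X f)"

section \<open>Exact categories\<close>

definition iso_arrow :: "('o, 'm, 'z) precategory_scheme \<Rightarrow> 'm \<Rightarrow> bool" where
  "iso_arrow C f \<longleftrightarrow> f \<in> Arr C \<and> (\<exists>g\<in>Hom C (Tgt C f) (Src C f).
     g \<bullet>\<^bsub>C\<^esub> f = Ide C (Src C f) \<and> f \<bullet>\<^bsub>C\<^esub> g = Ide C (Tgt C f))"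

definition is_kernel :: "('o, 'm, 'z) precategory_scheme \<Rightarrow> 'm \<Rightarrow> 'm \<Rightarrow> bool" where
  "is_kernel C i d \<longleftrightarrow> i \<in> Arr C \<and> d \<in> Arr C \<and> Tgt C i = Src C d \<and>
     d \<bullet>\<^bsub>C\<^esub> i = Zero C (Src C i) (Tgt C d) \<and>
     (\<forall>W\<in>Ob C. \<forall>f\<in>Hom C W (Src C d). d \<bullet>\<^bsub>C\<^esub> f = Zero C W (Tgt C d) \<longrightarrow>
        (\<exists>!g. g \<in> Hom C W (Src C i) \<and> i \<bullet>\<^bsub>C\<^esub> g = f))"

definition is_cokernel :: "('o, 'm, 'z) precategory_scheme \<Rightarrow> 'm \<Rightarrow> 'm \<Rightarrow> bool" where
  "is_cokernel C d i \<longleftrightarrow> i \<in> Arr C \<and> d \<in> Arr C \<and> Tgt C i = Src C d \<and>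
     d \<bullet>\<^bsub>C\<^esub> i = Zero C (Src C i) (Tgt C d) \<and>
     (\<forall>W\<in>Ob C. \<forall>f\<in>Hom C (Tgt C i) W. f \<bullet>\<^bsub>C\<^esub> i = Zero C (Src C i) W \<longrightarrow>
        (\<exists>!g. g \<in> Hom C (Tgt C d) W \<and> g \<bullet>\<^bsub>C\<^esub> d = f))"

text \<open>\<open>is_pullback C d f f' d'\<close>: the square with \<open>d \<bullet> f' = f \<bullet> d'\<close> is cartesian;
  \<open>d'\<close> is the base change of \<open>d\<close> along \<open>f\<close>.\<close>

definition is_pullback ::
    "('o, 'm, 'z) precategory_scheme \<Rightarrow> 'm \<Rightarrow> 'm \<Rightarrow> 'm \<Rightarrow> 'm \<Rightarrow> bool" where
  "is_pullback C d f f' d' \<longleftrightarrow>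
     d \<in> Arr C \<and> f \<in> Arr C \<and> f' \<in> Arr C \<and> d' \<in> Arr C \<and> Tgt C d = Tgt C f \<and>
     Src C f' = Src C d' \<and> Tgt C f' = Src C d \<and> Tgt C d' = Src C f \<and>
     d \<bullet>\<^bsub>C\<^esub> f' = f \<bullet>\<^bsub>C\<^esub> d' \<and>
     (\<forall>W\<in>Ob C. \<forall>u\<in>Hom C W (Src C d). \<forall>v\<in>Hom C W (Src C f). d \<bullet>\<^bsub>C\<^esub> u = f \<bullet>\<^bsub>C\<^esub> v \<longrightarrow>
        (\<exists>!w. w \<in> Hom C W (Src C d') \<and> f' \<bullet>\<^bsub>C\<^esub> w = u \<and> d' \<bullet>\<^bsub>C\<^esub> w = v))"

text \<open>\<open>is_pushout C i f f' i'\<close>: the square with \<open>f' \<bullet> i = i' \<bullet> f\<close> is cocartesian;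
  \<open>i'\<close> is the cobase change of \<open>i\<close> along \<open>f\<close>.\<close>

definition is_pushout ::
    "('o, 'm, 'z) precategory_scheme \<Rightarrow> 'm \<Rightarrow> 'm \<Rightarrow> 'm \<Rightarrow> 'm \<Rightarrow> bool" where
  "is_pushout C i f f' i' \<longleftrightarrow>
     i \<in> Arr C \<and> f \<in> Arr C \<and> f' \<in> Arr C \<and> i' \<in> Arr C \<and> Src C i = Src C f \<and>
     Tgt C f' = Tgt C i' \<and> Src C f' = Tgt C i \<and> Src C i' = Tgt C f \<and>
     f' \<bullet>\<^bsub>C\<^esub> i = i' \<bullet>\<^bsub>C\<^esub> f \<and>
     (\<forall>W\<in>Ob C. \<forall>u\<in>Hom C (Tgt C i) W. \<forall>v\<in>Hom C (Tgt C f) W. u \<bullet>\<^bsub>C\<^esub> i = v \<bullet>\<^bsub>C\<^esub> f \<longrightarrow>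
        (\<exists>!w. w \<in> Hom C (Tgt C i') W \<and> w \<bullet>\<^bsub>C\<^esub> f' = u \<and> w \<bullet>\<^bsub>C\<^esub> i' = v))"

text \<open>A conflation \<open>X \<rightarrow> Y \<rightarrow> Z\<close> is the pair \<open>(i, d)\<close> of its two morphisms.\<close>

definition inflation :: "('m \<times> 'm) set \<Rightarrow> 'm \<Rightarrow> bool" where
  "inflation \<E> i \<longleftrightarrow> (\<exists>d. (i, d) \<in> \<E>)"

definition deflation :: "('m \<times> 'm) set \<Rightarrow> 'm \<Rightarrow> bool" where
  "deflation \<E> d \<longleftrightarrow> (\<exists>i. (i, d) \<in> \<E>)"

text \<open>Quillen's axioms in the usual self-dual form (Quillen's additional condition on
  morphisms having a kernel or cokernel is a well-known consequence and is omitted).\<close>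

locale exact_category = additive_category C
  for C :: "('o, 'm, 'z) precategory_scheme" (structure) +
  fixes \<E> :: "('m \<times> 'm) set"
  assumes conflation_kernel: "(i, d) \<in> \<E> \<Longrightarrow> is_kernel C i d"
    and conflation_cokernel: "(i, d) \<in> \<E> \<Longrightarrow> is_cokernel C d i"
    and conflation_iso:
      "\<lbrakk>(i, d) \<in> \<E>; i' \<in> Arr C; d' \<in> Arr C; Tgt C i' = Src C d';
        iso_arrow C a; a \<in> Hom C (Src C i) (Src C i');
        iso_arrow C b; b \<in> Hom C (Tgt C i) (Tgt C i');
        iso_arrow C c; c \<in> Hom C (Tgt C d) (Tgt C d');
        b \<bullet> i = i' \<bullet> a; c \<bullet> d = d' \<bullet> b\<rbrakk> \<Longrightarrow> (i', d') \<in> \<E>"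
    and Ide_inflation: "X \<in> Ob C \<Longrightarrow> inflation \<E> (Ide C X)"
    and Ide_deflation: "X \<in> Ob C \<Longrightarrow> deflation \<E> (Ide C X)"
    and Cmp_inflation:
      "\<lbrakk>inflation \<E> f; inflation \<E> g; Tgt C f = Src C g\<rbrakk> \<Longrightarrow> inflation \<E> (g \<bullet> f)"
    and Cmp_deflation:
      "\<lbrakk>deflation \<E> f; deflation \<E> g; Tgt C f = Src C g\<rbrakk> \<Longrightarrow> deflation \<E> (g \<bullet> f)"
    and pushout_inflation:
      "\<lbrakk>inflation \<E> i; f \<in> Arr C; Src C f = Src C i\<rbrakk>
        \<Longrightarrow> \<exists>f' i'. is_pushout C i f f' i' \<and> inflation \<E> i'"
    and pullback_deflation:
      "\<lbrakk>deflation \<E> d; f \<in> Arr C; Tgt C f = Tgt C d\<rbrakk>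
        \<Longrightarrow> \<exists>f' d'. is_pullback C d f f' d' \<and> deflation \<E> d'"

section \<open>Acyclicity, projective and injective objects\<close>

text \<open>HOL-Algebra lists the terms of a short exact sequence from right to left.\<close>

definition Hom_from_exact :: "('o, 'm, 'z) precategory_scheme \<Rightarrow> 'o \<Rightarrow> 'm \<times> 'm \<Rightarrow> bool" where
  "Hom_from_exact C S = (\<lambda>(i, d).
     short_exact_sequence
       (Hom_group C S (Tgt C d)) (Hom_group C S (Tgt C i)) (Hom_group C S (Src C i))
       (\<lambda>f. d \<bullet>\<^bsub>C\<^esub> f) (\<lambda>f. i \<bullet>\<^bsub>C\<^esub> f))"

definition Hom_to_exact :: "('o, 'm, 'z) precategory_scheme \<Rightarrow> 'o \<Rightarrow> 'm \<times> 'm \<Rightarrow> bool" where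
  "Hom_to_exact C S = (\<lambda>(i, d).
     short_exact_sequence
       (Hom_group C (Src C i) S) (Hom_group C (Tgt C i) S) (Hom_group C (Tgt C d) S)
       (\<lambda>f. f \<bullet>\<^bsub>C\<^esub> i) (\<lambda>f. f \<bullet>\<^bsub>C\<^esub> d))"

definition right_acyclic ::
    "('o, 'm, 'z) precategory_scheme \<Rightarrow> ('m \<times> 'm) set \<Rightarrow> 'o set \<Rightarrow> ('m \<times> 'm) set" where
  "right_acyclic C \<E> \<S> = {\<eta> \<in> \<E>. \<forall>S\<in>\<S>. Hom_from_exact C S \<eta>}"

definition left_acyclic ::
    "('o, 'm, 'z) precategory_scheme \<Rightarrow> ('m \<times> 'm) set \<Rightarrow> 'o set \<Rightarrow> ('m \<times> 'm) set" where
  "left_acyclic C \<E> \<S> = {\<eta> \<in> \<E>. \<forall>S\<in>\<S>. Hom_to_exact C S \<eta>}"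

definition projectives ::
    "('o, 'm, 'z) precategory_scheme \<Rightarrow> ('m \<times> 'm) set \<Rightarrow> 'o set" where
  "projectives C \<E> = {P \<in> Ob C. \<forall>\<eta>\<in>\<E>. Hom_from_exact C P \<eta>}"

definition injectives ::
    "('o, 'm, 'z) precategory_scheme \<Rightarrow> ('m \<times> 'm) set \<Rightarrow> 'o set" where
  "injectives C \<E> = {I \<in> Ob C. \<forall>\<eta>\<in>\<E>. Hom_to_exact C I \<eta>}"

definition enough_projectives ::
    "('o, 'm, 'z) precategory_scheme \<Rightarrow> ('m \<times> 'm) set \<Rightarrow> bool" where
  "enough_projectives C \<E> \<longleftrightarrow>
     (\<forall>X\<in>Ob C. \<exists>P\<in>projectives C \<E>. \<exists>d\<in>Hom C P X. deflation \<E> d)"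

definition enough_injectives ::
    "('o, 'm, 'z) precategory_scheme \<Rightarrow> ('m \<times> 'm) set \<Rightarrow> bool" where
  "enough_injectives C \<E> \<longleftrightarrow>
     (\<forall>X\<in>Ob C. \<exists>I\<in>injectives C \<E>. \<exists>i\<in>Hom C X I. inflation \<E> i)"

locale frobenius_category = exact_category +
  assumes enough_projectives: "enough_projectives C \<E>"
    and enough_injectives: "enough_injectives C \<E>"
    and projectives_eq_injectives: "projectives C \<E> = injectives C \<E>"

end

(* A conflation is right I'-acyclic iff morphisms from I' lift along its deflation, and such
   deflations are stable under composition and base change; dually for inflations and left
   P'-acyclicity, so condition (3) makes E' an exact structure.  If a : S -> X is a right
   I'-approximation and d : P -> X a deflation with P projective, then (a, d) : S + P -> X is an
   E'-deflation with E'-projective source.  Hence E' has enough projectives, and splitting these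
   deflations shows that its projectives form the join of I' and P.  Applying this to the opposite
   category, its injectives form the join of P' and I, which is the same by condition (1). *)

theory Submission
  imports Defs
begin

section \<open>Opposite categories\<close>

text \<open>Neither ingredient of the cover suffices alone: the approximation \<open>a\<close> need
  not be a deflation, and morphisms from \<I>' need not lift along \<open>d\<close>. The combined
  morphism has both properties, but that it is a deflation must be extracted from the axioms. This
  is done with base changes only: projections of biproducts are base changes of morphisms to a zero
  object, and the combined morphism is a base change of \<open>d\<close> followed by a projection.
  The join is an intersection over many subcategories, so the cover is built on an arbitrary direct
  sum of \<open>S\<close> and \<open>P\<close>; its source can then be chosen inside each of them.
  Facts on projectives are stated for any subclass of \<E>, which makes them available for \<E>'
  independently of its exactness.\<close>

definition opposite ::
    "('o, 'm, 'z) precategory_scheme \<Rightarrow> ('o, 'm, 'z) precategory_scheme" where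
  "opposite C = C\<lparr>Src := Tgt C, Tgt := Src C, Cmp := \<lambda>g f. f \<bullet>\<^bsub>C\<^esub> g,
     Zero := \<lambda>X Y. Zero C Y X\<rparr>"

lemma opposite_simps [simp]:
  "Ob (opposite C) = Ob C"
  "Arr (opposite C) = Arr C"
  "Src (opposite C) = Tgt C"
  "Tgt (opposite C) = Src C"
  "Ide (opposite C) = Ide C"
  "g \<bullet>\<^bsub>opposite C\<^esub> f = f \<bullet>\<^bsub>C\<^esub> g"
  "Plus (opposite C) = Plus C"
  "Zero (opposite C) X Y = Zero C Y X"
  by (simp_all add: opposite_def)

lemma Hom_opposite [simp]: "Hom (opposite C) X Y = Hom C Y X"
  by (auto simp: Hom_def)

lemma Hom_group_opposite [simp]: "Hom_group (opposite C) X Y = Hom_group C Y X"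
  by (simp add: Hom_group_def)

lemma zero_object_opposite [simp]: "zero_object (opposite C) = zero_object C"
  by (auto simp: zero_object_def fun_eq_iff)

text \<open>Because \<open>opposite\<close> is a record update that keeps the extension fields, it
  is an involution up to equality. An implication proved for all categories therefore yields its
  converse when applied to the opposite.\<close>

lemma opposite_opposite [simp]: "opposite (opposite C) = C"
  by (simp add: opposite_def)

text \<open>A biproduct is self-dual: injections and projections trade places.\<close>

lemma direct_sum_opposite [simp]: "direct_sum (opposite C) = direct_sum C"
proof -
  have "direct_sum (opposite C) X Y S" if "direct_sum C X Y S"
    for C :: "('o, 'm, 'z) precategory_scheme" and X Y S
    using that unfolding direct_sum_def by simp blast
  from this[of C] this[of "opposite C"] show ?thesis
    by (auto simp: fun_eq_iff)
qed

lemma subcategory_join_opposite [simp]: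
  "subcategory_join (opposite C) = subcategory_join C"
  by (simp add: subcategory_join_def additive_subcategory_def summand_closed_def fun_eq_iff)

lemma iso_arrow_opposite [simp]: "iso_arrow (opposite C) = iso_arrow C"
  by (auto simp: iso_arrow_def fun_eq_iff)

lemma is_kernel_opposite [simp]: "is_kernel (opposite C) d i = is_cokernel C d i"
  by (auto simp: is_kernel_def is_cokernel_def)

lemma is_cokernel_opposite [simp]: "is_cokernel (opposite C) i d = is_kernel C i d"
  by (auto simp: is_kernel_def is_cokernel_def)

lemma is_pullback_opposite [simp]:
  "is_pullback (opposite C) i f f' i' = is_pushout C i f f' i'"
  by (auto simp: is_pullback_def is_pushout_def)

lemma is_pushout_opposite [simp]:
  "is_pushout (opposite C) d f f' d' = is_pullback C d f f' d'"
  by (auto simp: is_pullback_def is_pushout_def)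

lemma inflation_converse [simp]: "inflation (\<E>\<inverse>) = deflation \<E>"
  by (simp add: inflation_def deflation_def fun_eq_iff)

lemma deflation_converse [simp]: "deflation (\<E>\<inverse>) = inflation \<E>"
  by (simp add: inflation_def deflation_def fun_eq_iff)

text \<open>Both notions of exactness read the middle object off the target of the first arrow of
  the pair. In the opposite category this is the source of \<open>d\<close> instead of the target of
  \<open>i\<close>, hence the composability hypothesis.\<close>

lemma Hom_from_exact_opposite [simp]:
  "Tgt C i = Src C d \<Longrightarrow> Hom_from_exact (opposite C) S (d, i) = Hom_to_exact C S (i, d)"
  by (simp add: Hom_from_exact_def Hom_to_exact_def)

lemma contravariantly_finite_opposite [simp]:
  "contravariantly_finite (opposite C) \<S> = covariantly_finite C \<S>"
  by (simp add: contravariantly_finite_def covariantly_finite_def right_approximation_def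
      left_approximation_def additive_subcategory_def)

lemma (in additive_category) additive_category_opposite: "additive_category (opposite C)"
proof (intro additive_category.intro preadditive_category.intro category.intro
    preadditive_category_axioms.intro additive_category_axioms.intro)
  show "comm_group (Hom_group (opposite C) X Y)"
    if "X \<in> Ob (opposite C)" "Y \<in> Ob (opposite C)" for X Y
    using that by (simp add: Hom_comm_group)
qed (auto simp: Src_Ob Tgt_Ob Ide_Hom Cmp_Ide Ide_Cmp Cmp_assoc
    Cmp_Plus_right Cmp_Plus_left ex_zero_object ex_direct_sum intro: Cmp_Hom)

section \<open>Inverses and commuting squares\<close>

context category
begin

lemma Hom_D: "f \<in> Hom C X Y \<Longrightarrow> f \<in> Arr C \<and> Src C f = X \<and> Tgt C f = Y \<and> X \<in> Ob C \<and> Y \<in> Ob C"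
  using Src_Ob Tgt_Ob by (auto simp: Hom_def)

lemma Hom_I: "f \<in> Arr C \<Longrightarrow> f \<in> Hom C (Src C f) (Tgt C f)"
  by (simp add: Hom_def)

lemma iso_arrow_inverse:
  assumes "iso_arrow C f" and "f \<in> Hom C X Y"
  obtains g where "iso_arrow C g" and "g \<in> Hom C Y X" and "g \<bullet> f = Ide C X" and "f \<bullet> g = Ide C Y"
  using assms unfolding iso_arrow_def Hom_def by auto

text \<open>Reverses the vertical arrows of a commuting square: insert \<open>a \<bullet> a'\<close>
  after \<open>f'\<close> on the source side, move across the square, and cancel
  \<open>b' \<bullet> b\<close>.\<close>

lemma inverse_square:
  assumes "a \<in> Hom C X X'" "a' \<in> Hom C X' X" "a \<bullet> a' = Ide C X'"
    and "b \<in> Hom C Y Y'" "b' \<in> Hom C Y' Y" "b' \<bullet> b = Ide C Y"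
    and "f \<in> Hom C X Y" "f' \<in> Hom C X' Y'" "b \<bullet> f = f' \<bullet> a"
  shows "b' \<bullet> f' = f \<bullet> a'"
proof -
  have "b' \<bullet> f' = b' \<bullet> (f' \<bullet> (a \<bullet> a'))"
    using assms Cmp_Ide by simp
  also have "\<dots> = b' \<bullet> ((b \<bullet> f) \<bullet> a')"
    using assms Cmp_assoc[of a' X' X a X' f' Y'] by simp
  also have "\<dots> = (b' \<bullet> (b \<bullet> f)) \<bullet> a'"
    using assms Cmp_assoc Cmp_Hom by metis
  also have "\<dots> = f \<bullet> a'"
    using assms Cmp_assoc[of f X Y b Y' b' Y] Ide_Cmp by simp
  finally show ?thesis .
qed

end

lemma (in exact_category) conflation_Hom:
  assumes "(i, d) \<in> \<E>"
  shows "i \<in> Hom C (Src C i) (Tgt C i)" and "d \<in> Hom C (Tgt C i) (Tgt C d)"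
    and "Tgt C i = Src C d"
  using conflation_kernel[OF assms] by (auto simp: is_kernel_def Hom_def)

text \<open>The axioms come in dual pairs, so most of them transfer by rewriting. Closure under
  isomorphism is the exception: the given isomorphisms of sequences point backwards in
  \<open>C\<close>, and their inverses have to be fed into the axiom.\<close>

lemma (in exact_category) exact_category_opposite: "exact_category (opposite C) (\<E>\<inverse>)"
proof (intro exact_category.intro exact_category_axioms.intro additive_category_opposite)
  fix i d i' d' a b c
  assume 1: "(i, d) \<in> \<E>\<inverse>" and 2: "i' \<in> Arr (opposite C)" "d' \<in> Arr (opposite C)"
      "Tgt (opposite C) i' = Src (opposite C) d'"
    and a: "iso_arrow (opposite C) a" "a \<in> Hom (opposite C) (Src (opposite C) i) (Src (opposite C) i')"
    and b: "iso_arrow (opposite C) b" "b \<in> Hom (opposite C) (Tgt (opposite C) i) (Tgt (opposite C) i')"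
    and c: "iso_arrow (opposite C) c" "c \<in> Hom (opposite C) (Tgt (opposite C) d) (Tgt (opposite C) d')"
    and eq: "b \<bullet>\<^bsub>opposite C\<^esub> i = i' \<bullet>\<^bsub>opposite C\<^esub> a"
      "c \<bullet>\<^bsub>opposite C\<^esub> d = d' \<bullet>\<^bsub>opposite C\<^esub> b"
  obtain a' where a': "iso_arrow C a'" "a' \<in> Hom C (Tgt C i) (Tgt C i')"
      "a' \<bullet> a = Ide C (Tgt C i')" "a \<bullet> a' = Ide C (Tgt C i)"
    using iso_arrow_inverse[of a] a by auto
  obtain b' where b': "iso_arrow C b'" "b' \<in> Hom C (Src C i) (Src C i')"
      "b' \<bullet> b = Ide C (Src C i')" "b \<bullet> b' = Ide C (Src C i)"
    using iso_arrow_inverse[of b] b by auto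
  obtain c' where c': "iso_arrow C c'" "c' \<in> Hom C (Src C d) (Src C d')"
      "c' \<bullet> c = Ide C (Src C d')" "c \<bullet> c' = Ide C (Src C d)"
    using iso_arrow_inverse[of c] c by auto
  have *: "(d, i) \<in> \<E>" "i' \<in> Arr C" "d' \<in> Arr C" "Tgt C d' = Src C i'"
    using 1 2 by auto
  have **: "Tgt C d = Src C i"
    using conflation_Hom[OF *(1)] by (auto simp: Hom_def)
  have "b' \<bullet> d = d' \<bullet> c'"
    by (rule inverse_square[OF _ c'(2,4) _ b'(2,3)])
      (use b c eq ** * conflation_Hom[OF *(1)] in \<open>auto simp: Hom_def\<close>)
  moreover have "a' \<bullet> i = i' \<bullet> b'"
    by (rule inverse_square[OF _ b'(2,4) _ a'(2,3)])
      (use a b eq ** * conflation_Hom[OF *(1)] in \<open>auto simp: Hom_def\<close>)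
  ultimately show "(i', d') \<in> \<E>\<inverse>"
    using conflation_iso[OF *(1,3,2,4) c'(1,2) b'(1)  _ a'(1,2)] b'(2) * ** by simp
qed (auto simp: conflation_kernel conflation_cokernel Ide_inflation Ide_deflation
    Cmp_inflation Cmp_deflation pushout_inflation pullback_deflation)

section \<open>Duality for acyclic conflations, projectives and injectives\<close>

context exact_category
begin

lemma right_acyclic_opposite: "right_acyclic (opposite C) (\<E>\<inverse>) \<S> = (left_acyclic C \<E> \<S>)\<inverse>"
  using conflation_Hom(3) by (auto simp: right_acyclic_def left_acyclic_def)

text \<open>The class \<F> is kept general because both \<E> and its left acyclic part are dualized
  this way. The inclusion in \<E> guarantees that the pairs are composable.\<close>

lemma projectives_opposite:
  assumes "\<F> \<subseteq> \<E>"
  shows "projectives (opposite C) (\<F>\<inverse>) = injectives C \<F>"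
proof -
  have "Hom_from_exact (opposite C) P (d, i) = Hom_to_exact C P (i, d)" if "(i, d) \<in> \<F>" for i d P
    using that assms conflation_Hom(3) by auto
  then show ?thesis
    by (fastforce simp: projectives_def injectives_def)
qed

lemma enough_projectives_opposite:
  assumes "\<F> \<subseteq> \<E>"
  shows "enough_projectives (opposite C) (\<F>\<inverse>) = enough_injectives C \<F>"
  using assms by (simp add: enough_projectives_def enough_injectives_def projectives_opposite)

end

section \<open>Biproducts\<close>

context preadditive_category
begin

lemma Zero_Hom: "X \<in> Ob C \<Longrightarrow> Y \<in> Ob C \<Longrightarrow> Zero C X Y \<in> Hom C X Y"
  using Hom_comm_group[THEN comm_group.axioms(2), THEN group.is_monoid, THEN monoid.one_closed]
  by (simp add: Hom_group_def)

lemma Plus_Hom: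
  assumes "f \<in> Hom C X Y" "g \<in> Hom C X Y"
  shows "f \<^bold>+ g \<in> Hom C X Y"
proof -
  interpret comm_group "Hom_group C X Y"
    using assms Hom_D by (intro Hom_comm_group) auto
  show ?thesis using m_closed assms by (simp add: Hom_group_def)
qed

lemma Plus_commute:
  assumes "f \<in> Hom C X Y" "g \<in> Hom C X Y"
  shows "f \<^bold>+ g = g \<^bold>+ f"
proof -
  interpret comm_group "Hom_group C X Y"
    using assms Hom_D by (intro Hom_comm_group) auto
  show ?thesis using m_comm assms by (simp add: Hom_group_def)
qed

lemma Plus_assoc:
  assumes "f \<in> Hom C X Y" "g \<in> Hom C X Y" "h \<in> Hom C X Y"
  shows "(f \<^bold>+ g) \<^bold>+ h = f \<^bold>+ (g \<^bold>+ h)"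
proof -
  interpret comm_group "Hom_group C X Y"
    using assms Hom_D by (intro Hom_comm_group) auto
  show ?thesis using m_assoc assms by (simp add: Hom_group_def)
qed

lemma Zero_Plus:
  assumes "f \<in> Hom C X Y"
  shows "Zero C X Y \<^bold>+ f = f"
proof -
  interpret comm_group "Hom_group C X Y"
    using assms Hom_D by (intro Hom_comm_group) auto
  show ?thesis using l_one assms by (simp add: Hom_group_def)
qed

lemma Plus_Zero: "f \<in> Hom C X Y \<Longrightarrow> f \<^bold>+ Zero C X Y = f"
  using Zero_Plus Plus_commute Zero_Hom Hom_D by metis

lemma ex_negative:
  assumes "f \<in> Hom C X Y"
  obtains g where "g \<in> Hom C X Y" "f \<^bold>+ g = Zero C X Y"
proof -
  interpret comm_group "Hom_group C X Y"
    using assms Hom_D by (intro Hom_comm_group) auto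
  show ?thesis
    using that[of "inv\<^bsub>Hom_group C X Y\<^esub> f"] inv_closed[of f] r_inv[of f] assms
    by (simp add: Hom_group_def)
qed

lemma Plus_left_cancel:
  assumes "f \<in> Hom C X Y" "g \<in> Hom C X Y" "h \<in> Hom C X Y" and "f \<^bold>+ g = f \<^bold>+ h"
  shows "g = h"
proof -
  interpret comm_group "Hom_group C X Y"
    using assms Hom_D by (intro Hom_comm_group) auto
  have "f \<in> Units (Hom_group C X Y)"
    using assms Units_eq by (simp add: Hom_group_def)
  from Units_l_cancel[OF this, of g h] show ?thesis
    using assms by (simp add: Hom_group_def)
qed

lemma Cmp_Zero:
  assumes "g \<in> Hom C Y Z" "X \<in> Ob C"
  shows "g \<bullet> Zero C X Y = Zero C X Z"
proof -
  have z: "Zero C X Y \<in> Hom C X Y" "Zero C X Z \<in> Hom C X Z" "g \<bullet> Zero C X Y \<in> Hom C X Z"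
    using assms Hom_D[OF assms(1)] Zero_Hom by (auto intro: Cmp_Hom)
  \<comment> \<open>In a group, \<open>x + x = x\<close> forces \<open>x = 0\<close>.\<close>
  have "g \<bullet> Zero C X Y \<^bold>+ g \<bullet> Zero C X Y = g \<bullet> Zero C X Y"
    using Cmp_Plus_right[OF z(1,1) assms(1)] Zero_Plus[OF z(1)] by simp
  also have "\<dots> = g \<bullet> Zero C X Y \<^bold>+ Zero C X Z"
    using Plus_Zero[OF z(3)] by simp
  finally show ?thesis
    using Plus_left_cancel[OF z(3,3,2)] by simp
qed

lemma Zero_Cmp:
  assumes "f \<in> Hom C X Y" "Z \<in> Ob C"
  shows "Zero C Y Z \<bullet> f = Zero C X Z"
proof -
  have z: "Zero C Y Z \<in> Hom C Y Z" "Zero C X Z \<in> Hom C X Z" "Zero C Y Z \<bullet> f \<in> Hom C X Z"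
    using assms Hom_D[OF assms(1)] Zero_Hom by (auto intro: Cmp_Hom)
  have "Zero C Y Z \<bullet> f \<^bold>+ Zero C Y Z \<bullet> f = Zero C Y Z \<bullet> f"
    using Cmp_Plus_left[OF assms(1) z(1,1)] Zero_Plus[OF z(1)] by simp
  also have "\<dots> = Zero C Y Z \<bullet> f \<^bold>+ Zero C X Z"
    using Plus_Zero[OF z(3)] by simp
  finally show ?thesis
    using Plus_left_cancel[OF z(3,3,2)] by simp
qed

section \<open>Kernels and exactness of Hom\<close>

lemma kernel_factor:
  assumes "is_kernel C i d" and "f \<in> Hom C W (Src C d)" and "d \<bullet> f = Zero C W (Tgt C d)"
  obtains g where "g \<in> Hom C W (Src C i)" "i \<bullet> g = f"
  using assms Hom_D[OF assms(2)] unfolding is_kernel_def by blast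

lemma kernel_mono:
  assumes "is_kernel C i d" and "f \<in> Hom C W (Src C i)" "g \<in> Hom C W (Src C i)" and "i \<bullet> f = i \<bullet> g"
  shows "f = g"
proof -
  have id: "i \<in> Hom C (Src C i) (Src C d)" "d \<in> Hom C (Src C d) (Tgt C d)"
    using assms(1) by (auto simp: is_kernel_def Hom_def)
  have "d \<bullet> (i \<bullet> f) = (d \<bullet> i) \<bullet> f"
    using Cmp_assoc[OF assms(2) id] .
  also have "\<dots> = Zero C W (Tgt C d)"
    using assms(1) Zero_Cmp[OF assms(2)] Hom_D[OF id(2)] by (simp add: is_kernel_def)
  finally have "\<exists>!g. g \<in> Hom C W (Src C i) \<and> i \<bullet> g = i \<bullet> f"
    using assms(1) Cmp_Hom[OF assms(2) id(1)] Hom_D[OF assms(2)] unfolding is_kernel_def by blast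
  then show ?thesis
    using assms by metis
qed

text \<open>The kernel property alone makes \<open>i \<bullet> _\<close> injective and gives
  exactness in the middle, for every \<open>T\<close>. Only surjectivity of
  \<open>d \<bullet> _\<close> remains as a condition.\<close>

lemma Hom_from_exact_iff:
  assumes k: "is_kernel C i d" and T: "T \<in> Ob C"
  shows "Hom_from_exact C T (i, d) \<longleftrightarrow>
    (\<forall>g\<in>Hom C T (Tgt C d). \<exists>h\<in>Hom C T (Src C d). d \<bullet> h = g)" (is "_ \<longleftrightarrow> ?lifts")
proof
  assume "Hom_from_exact C T (i, d)"
  then have "(\<lambda>f. d \<bullet> f) \<in> epi (Hom_group C T (Tgt C i)) (Hom_group C T (Tgt C d))"
    by (simp add: Hom_from_exact_def short_exact_sequence_iff)
  moreover have "Tgt C i = Src C d"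
    using k by (simp add: is_kernel_def)
  ultimately have im: "(\<lambda>f. d \<bullet> f) ` Hom C T (Src C d) = Hom C T (Tgt C d)"
    by (simp add: epi_def Hom_group_def)
  show ?lifts
  proof
    fix g assume "g \<in> Hom C T (Tgt C d)"
    then have "g \<in> (\<lambda>f. d \<bullet> f) ` Hom C T (Src C d)"
      unfolding im .
    then show "\<exists>h\<in>Hom C T (Src C d). d \<bullet> h = g"
      by (rule imageE) auto
  qed
next
  assume lifts: ?lifts
  have id: "i \<in> Hom C (Src C i) (Src C d)" "d \<in> Hom C (Src C d) (Tgt C d)" "Tgt C i = Src C d"
    using k by (auto simp: is_kernel_def Hom_def)
  then have ob: "Src C i \<in> Ob C" "Src C d \<in> Ob C" "Tgt C d \<in> Ob C"
    using Hom_D by blast+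
  have grp: "group (Hom_group C T X)" if "X \<in> Ob C" for X
    using Hom_comm_group[OF T that] by (simp add: comm_group.axioms(2))
  have hom: "(\<lambda>h. f \<bullet> h) \<in> hom (Hom_group C T X) (Hom_group C T Y)" if "f \<in> Hom C X Y" for f X Y
    using that Cmp_Hom Cmp_Plus_right by (auto simp: hom_def Hom_group_def)
  have "kernel (Hom_group C T (Src C d)) (Hom_group C T (Tgt C d)) (\<lambda>h. d \<bullet> h)
      = (\<lambda>h. i \<bullet> h) ` carrier (Hom_group C T (Src C i))" (is "?ker = ?im")
  proof (intro subset_antisym subsetI)
    fix f assume "f \<in> ?ker"
    then have "f \<in> Hom C T (Src C d)" "d \<bullet> f = Zero C T (Tgt C d)"
      by (auto simp: kernel_def Hom_group_def)
    then obtain g where "g \<in> Hom C T (Src C i)" "i \<bullet> g = f"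
      using kernel_factor[OF k] by metis
    then show "f \<in> ?im"
      by (auto simp: Hom_group_def)
  next
    fix f assume "f \<in> ?im"
    then obtain g where g: "g \<in> Hom C T (Src C i)" "f = i \<bullet> g"
      by (auto simp: Hom_group_def)
    have "d \<bullet> f = (d \<bullet> i) \<bullet> g"
      using Cmp_assoc[OF g(1) id(1,2)] g(2) by simp
    also have "\<dots> = Zero C T (Tgt C d)"
      using k Zero_Cmp[OF g(1) ob(3)] by (simp add: is_kernel_def)
    finally show "f \<in> ?ker"
      using g Cmp_Hom[OF g(1) id(1)] by (simp add: kernel_def Hom_group_def)
  qed
  moreover have "inj_on (\<lambda>h. i \<bullet> h) (Hom C T (Src C i))"
    using kernel_mono[OF k] by (simp add: inj_on_def)
  moreover have "(\<lambda>h. d \<bullet> h) ` Hom C T (Src C d) = Hom C T (Tgt C d)"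
    using lifts Cmp_Hom id(2) by (force simp: image_iff)
  ultimately show "Hom_from_exact C T (i, d)"
    using grp hom id ob
    by (simp add: Hom_from_exact_def short_exact_sequence_iff epi_def mon_def
        group_hom_def group_hom_axioms_def) (simp add: Hom_group_def)
qed

end

text \<open>Names the four structure morphisms that \<open>direct_sum\<close> hides behind
  existential quantifiers, since pairings and copairings are written in terms of them.\<close>

definition biproduct :: "('o, 'm, 'z) precategory_scheme \<Rightarrow> 'o \<Rightarrow> 'o \<Rightarrow> 'o \<Rightarrow>
    'm \<Rightarrow> 'm \<Rightarrow> 'm \<Rightarrow> 'm \<Rightarrow> bool" where
  "biproduct C X Y S i j p q \<longleftrightarrow>
     i \<in> Hom C X S \<and> j \<in> Hom C Y S \<and> p \<in> Hom C S X \<and> q \<in> Hom C S Y \<and>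
     p \<bullet>\<^bsub>C\<^esub> i = Ide C X \<and> q \<bullet>\<^bsub>C\<^esub> j = Ide C Y \<and>
     p \<bullet>\<^bsub>C\<^esub> j = Zero C Y X \<and> q \<bullet>\<^bsub>C\<^esub> i = Zero C X Y \<and>
     (i \<bullet>\<^bsub>C\<^esub> p) \<^bold>+\<^bsub>C\<^esub> (j \<bullet>\<^bsub>C\<^esub> q) = Ide C S"

lemma (in category) direct_sum_iff_biproduct:
  "direct_sum C X Y S \<longleftrightarrow> (\<exists>i j p q. biproduct C X Y S i j p q)"
  using Hom_D unfolding direct_sum_def biproduct_def by blast

context preadditive_category
begin

text \<open>Composing the identity \<open>i \<bullet> p + j \<bullet> q = 1\<close> with a morphism
  recovers it from its two components.\<close>

lemma biproduct_ext:
  assumes b: "biproduct C X Y S i j p q" and uv: "u \<in> Hom C W S" "v \<in> Hom C W S"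
    and "p \<bullet> u = p \<bullet> v" "q \<bullet> u = q \<bullet> v"
  shows "u = v"
proof -
  have h: "i \<in> Hom C X S" "j \<in> Hom C Y S" "p \<in> Hom C S X" "q \<in> Hom C S Y"
    and e: "(i \<bullet> p) \<^bold>+ (j \<bullet> q) = Ide C S"
    using b by (auto simp: biproduct_def)
  have "w = i \<bullet> (p \<bullet> w) \<^bold>+ j \<bullet> (q \<bullet> w)" if w: "w \<in> Hom C W S" for w
    using Cmp_Plus_left[OF w Cmp_Hom[OF h(3,1)] Cmp_Hom[OF h(4,2)]] Ide_Cmp[OF w]
      Cmp_assoc[OF w h(3,1)] Cmp_assoc[OF w h(4,2)] e by simp
  from this[OF uv(1)] this[OF uv(2)] assms show ?thesis
    by simp
qed

lemma biproduct_pair: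
  assumes bp: "biproduct C X Y S i j p q" and a: "a \<in> Hom C W X" and b: "b \<in> Hom C W Y"
  obtains w where "w \<in> Hom C W S" "p \<bullet> w = a" "q \<bullet> w = b"
proof -
  have h: "i \<in> Hom C X S" "j \<in> Hom C Y S" "p \<in> Hom C S X" "q \<in> Hom C S Y"
    and e: "p \<bullet> i = Ide C X" "q \<bullet> j = Ide C Y" "p \<bullet> j = Zero C Y X" "q \<bullet> i = Zero C X Y"
    using bp by (auto simp: biproduct_def)
  have ob: "X \<in> Ob C" "Y \<in> Ob C"
    using Hom_D a b by auto
  note ia = Cmp_Hom[OF a h(1)] and jb = Cmp_Hom[OF b h(2)]
  have "p \<bullet> (i \<bullet> a \<^bold>+ j \<bullet> b) = a"
    using Cmp_Plus_right[OF ia jb h(3)] Cmp_assoc[OF a h(1,3)] Cmp_assoc[OF b h(2,3)] e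
      Ide_Cmp[OF a] Zero_Cmp[OF b ob(1)] Plus_Zero[OF a] by simp
  moreover have "q \<bullet> (i \<bullet> a \<^bold>+ j \<bullet> b) = b"
    using Cmp_Plus_right[OF ia jb h(4)] Cmp_assoc[OF a h(1,4)] Cmp_assoc[OF b h(2,4)] e
      Ide_Cmp[OF b] Zero_Cmp[OF a ob(2)] Zero_Plus[OF b] by simp
  ultimately show ?thesis
    using that Plus_Hom[OF ia jb] by blast
qed

lemma copair_Hom:
  assumes "biproduct C X Y S i j p q" "a \<in> Hom C X Z" "b \<in> Hom C Y Z"
  shows "a \<bullet> p \<^bold>+ b \<bullet> q \<in> Hom C S Z"
  using assms by (auto simp: biproduct_def intro: Plus_Hom Cmp_Hom)

lemma copair_Cmp:
  assumes bp: "biproduct C X Y S i j p q" and a: "a \<in> Hom C X Z" and b: "b \<in> Hom C Y Z"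
    and w: "w \<in> Hom C W S"
  shows "(a \<bullet> p \<^bold>+ b \<bullet> q) \<bullet> w = a \<bullet> (p \<bullet> w) \<^bold>+ b \<bullet> (q \<bullet> w)"
proof -
  have h: "p \<in> Hom C S X" "q \<in> Hom C S Y"
    using bp by (auto simp: biproduct_def)
  show ?thesis
    using Cmp_Plus_left[OF w Cmp_Hom[OF h(1) a] Cmp_Hom[OF h(2) b]]
      Cmp_assoc[OF w h(1) a] Cmp_assoc[OF w h(2) b] by simp
qed

lemma copair_inl:
  assumes bp: "biproduct C X Y S i j p q" and a: "a \<in> Hom C X Z" and b: "b \<in> Hom C Y Z"
  shows "(a \<bullet> p \<^bold>+ b \<bullet> q) \<bullet> i = a"
  using copair_Cmp[OF bp a b, of i X] bp Cmp_Ide[OF a] Cmp_Zero[OF b, of X] Plus_Zero[OF a] Hom_D[OF a]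
  by (simp add: biproduct_def)

text \<open>The complement of \<open>X\<close> is the kernel of \<open>m\<close>: the endomorphism
  \<open>1 - s \<bullet> m\<close> is killed by \<open>m\<close>, so it factors as
  \<open>k \<bullet> q\<close>, and this \<open>q\<close> is the missing projection.\<close>

lemma split_epi_direct_sum:
  assumes k: "is_kernel C k m" and m: "m \<in> Hom C D X" and s: "s \<in> Hom C X D"
    and ms: "m \<bullet> s = Ide C X"
  shows "direct_sum C X (Src C k) D"
proof -
  have kH: "k \<in> Hom C (Src C k) D" and mk: "m \<bullet> k = Zero C (Src C k) X" and D: "D \<in> Ob C"
    and X: "X \<in> Ob C" and K: "Src C k \<in> Ob C"
    using k m Hom_D[OF m] Src_Ob by (auto simp: is_kernel_def Hom_def)
  have sm: "s \<bullet> m \<in> Hom C D D" and 1: "Ide C D \<in> Hom C D D"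
    using m s D by (auto intro: Cmp_Hom Ide_Hom)
  obtain n where n: "n \<in> Hom C D D" "s \<bullet> m \<^bold>+ n = Zero C D D"
    using ex_negative[OF sm] .
  \<comment> \<open>Here \<open>n\<close> is the negative of \<open>s \<bullet> m\<close>, so
    \<open>e\<close> stands for \<open>1 - s \<bullet> m\<close>.\<close>
  define e where "e = Ide C D \<^bold>+ n"
  have e: "e \<in> Hom C D D"
    using Plus_Hom[OF 1 n(1)] by (simp add: e_def)
  have sme: "s \<bullet> m \<^bold>+ e = Ide C D"
    using Plus_commute[OF 1 n(1)] Plus_assoc[OF sm n(1) 1] n(2) Zero_Plus[OF 1] by (simp add: e_def)
  have eq: "s \<bullet> (m \<bullet> w) \<^bold>+ e \<bullet> w = w" if w: "w \<in> Hom C W D" for w W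
    using Cmp_Plus_left[OF w sm e] sme Ide_Cmp[OF w] Cmp_assoc[OF w m s] by simp
  have es: "e \<bullet> s = Zero C X D"
    using eq[OF s] ms Cmp_Ide[OF s] Plus_Zero[OF s]
      Plus_left_cancel[OF s Cmp_Hom[OF s e] Zero_Hom[OF X D]] by simp
  have ek: "e \<bullet> k = k"
    using eq[OF kH] mk Cmp_Zero[OF s K] Zero_Plus[OF Cmp_Hom[OF kH e]] by simp
  have "m \<bullet> (s \<bullet> m) = m"
    using Cmp_assoc[OF m s m] ms Ide_Cmp[OF m] by simp
  then have "m \<^bold>+ m \<bullet> e = m"
    using Cmp_Plus_right[OF sm e m] sme Cmp_Ide[OF m] by simp
  then have "m \<bullet> e = Zero C D X"
    using Plus_left_cancel[OF m Cmp_Hom[OF e m] Zero_Hom[OF D X]] Plus_Zero[OF m] by simp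
  then obtain q where q: "q \<in> Hom C D (Src C k)" "k \<bullet> q = e"
    using kernel_factor[OF k, of e D] k e Hom_D[OF m] Hom_D[OF kH] by (auto simp: is_kernel_def)
  \<comment> \<open>Both remaining biproduct equations are checked after composing with the
    monomorphism \<open>k\<close>, where \<open>k \<bullet> q\<close> becomes
    \<open>e\<close>.\<close>
  have "q \<bullet> k = Ide C (Src C k)"
    by (rule kernel_mono[OF k Cmp_Hom[OF kH q(1)] Ide_Hom[OF K]])
      (use Cmp_assoc[OF kH q(1) kH] q(2) ek Cmp_Ide[OF kH] in simp)
  moreover have "q \<bullet> s = Zero C X (Src C k)"
    by (rule kernel_mono[OF k Cmp_Hom[OF s q(1)] Zero_Hom[OF X K]])
      (use Cmp_assoc[OF s q(1) kH] q(2) es Cmp_Zero[OF kH X] in simp)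
  ultimately have "biproduct C X (Src C k) D s k m q"
    using kH m s q sme ms mk by (simp add: biproduct_def)
  then show ?thesis
    unfolding direct_sum_iff_biproduct by blast
qed

end

section \<open>Deflations\<close>

context exact_category
begin

lemma deflation_Arr: "deflation \<E> d \<Longrightarrow> d \<in> Arr C"
  using conflation_kernel by (auto simp: deflation_def is_kernel_def)

lemma deflation_iso:
  assumes "iso_arrow C f"
  shows "deflation \<E> f"
proof -
  have f: "f \<in> Hom C (Src C f) (Tgt C f)"
    using assms by (simp add: iso_arrow_def Hom_I)
  then obtain g where g: "iso_arrow C g" "g \<in> Hom C (Tgt C f) (Src C f)"
      "f \<bullet> g = Ide C (Tgt C f)"
    using iso_arrow_inverse assms by metis
  have Y: "Tgt C f \<in> Ob C" and IY: "Ide C (Tgt C f) \<in> Hom C (Tgt C f) (Tgt C f)"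
    using Hom_D[OF f] Ide_Hom by auto
  obtain k where k: "(k, Ide C (Tgt C f)) \<in> \<E>"
    using Ide_deflation[OF Y] by (auto simp: deflation_def)
  have kH: "k \<in> Hom C (Src C k) (Tgt C f)"
    using conflation_Hom[OF k] Hom_D[OF IY] by simp
  have gk: "g \<bullet> k \<in> Hom C (Src C k) (Src C f)"
    using Cmp_Hom[OF kH g(2)] .
  have K: "Src C k \<in> Ob C"
    using Hom_D[OF kH] by simp
  have iso_Ide: "iso_arrow C (Ide C X)" if "X \<in> Ob C" for X
    using Ide_Hom[OF that] Cmp_Ide[OF Ide_Hom[OF that]] Hom_D[OF Ide_Hom[OF that]]
    by (auto simp: iso_arrow_def)
  \<comment> \<open>The identity of the target of \<open>f\<close> is a deflation with some kernel
    \<open>k\<close>; transporting the middle object of this conflation along the inverse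
    \<open>g\<close> turns the identity into \<open>f\<close>.\<close>
  have "(g \<bullet> k, f) \<in> \<E>"
    by (rule conflation_iso[OF k _ _ _ iso_Ide[OF K] _ g(1) _ iso_Ide[OF Y]])
      (use gk f g Hom_D[OF f] Hom_D[OF gk] Hom_D[OF kH] Hom_D[OF IY] IY Ide_Hom[OF K]
         Cmp_Ide[OF gk] Cmp_Ide[OF IY] in auto)
  then show ?thesis
    by (auto simp: deflation_def)
qed

text \<open>The axiom only promises that some pullback of \<open>d\<close> along \<open>f\<close> is
  a deflation. Any other pullback differs from it by an isomorphism, and isomorphisms are deflations
  that can be composed with it.\<close>

lemma deflation_base_change:
  assumes d: "deflation \<E> d" and pb: "is_pullback C d f f' d'"
  shows "deflation \<E> d'"
proof -
  have "f \<in> Arr C" "Tgt C f = Tgt C d"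
    using pb by (auto simp: is_pullback_def)
  then obtain f2 d2 where pb2: "is_pullback C d f f2 d2" and d2: "deflation \<E> d2"
    using pullback_deflation[OF d] by blast
  have uniq: "\<exists>!w. w \<in> Hom C W (Src C d2) \<and> f1 \<bullet> w = u \<and> d2 \<bullet> w = v"
    if "is_pullback C d f f1 d2" "u \<in> Hom C W (Src C d)" "v \<in> Hom C W (Src C f)" "d \<bullet> u = f \<bullet> v"
    for u v W f1 d2
    using that Hom_D[OF that(2)] unfolding is_pullback_def by blast
  have H: "f1 \<in> Hom C (Src C d1) (Src C d)" "d1 \<in> Hom C (Src C d1) (Src C f)" "d \<bullet> f1 = f \<bullet> d1"
    if "is_pullback C d f f1 d1" for f1 d1
    using that by (auto simp: is_pullback_def Hom_def)
  note H1 = H[OF pb] and H2 = H[OF pb2]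
  obtain w where w: "w \<in> Hom C (Src C d') (Src C d2)" "f2 \<bullet> w = f'" "d2 \<bullet> w = d'"
    using uniq[OF pb2 H1] by blast
  obtain v where v: "v \<in> Hom C (Src C d2) (Src C d')" "f' \<bullet> v = f2" "d' \<bullet> v = d2"
    using uniq[OF pb H2] by blast
  \<comment> \<open>The composite and the identity both solve the same pullback problem, so
    uniqueness identifies them.\<close>
  have "w \<bullet> v = Ide C (Src C d2)"
    using uniq[OF pb2 H2] Cmp_Hom[OF v(1) w(1)] Cmp_assoc[OF v(1) w(1) H2(1)]
      Cmp_assoc[OF v(1) w(1) H2(2)] w v Cmp_Ide[OF H2(1)] Cmp_Ide[OF H2(2)] Ide_Hom Hom_D[OF w(1)]
    by metis
  moreover have "v \<bullet> w = Ide C (Src C d')"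
    using uniq[OF pb H1] Cmp_Hom[OF w(1) v(1)] Cmp_assoc[OF w(1) v(1) H1(1)]
      Cmp_assoc[OF w(1) v(1) H1(2)] w v Cmp_Ide[OF H1(1)] Cmp_Ide[OF H1(2)] Ide_Hom Hom_D[OF w(1)]
    by metis
  ultimately have "iso_arrow C w"
    using w(1) v(1) Hom_D[OF w(1)] by (auto simp: iso_arrow_def)
  then have "deflation \<E> (d2 \<bullet> w)"
    using Cmp_deflation[OF deflation_iso d2] Hom_D[OF w(1)] by simp
  then show ?thesis
    using w(3) by simp
qed

text \<open>Take the cokernel \<open>d\<close> of the identity of \<open>X\<close>. Then
  \<open>d = d \<bullet> 1 = 0\<close>, and since factorizations through \<open>d\<close> are
  unique, the identity of its target is zero as well.\<close>

lemma deflation_to_zero: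
  assumes X: "X \<in> Ob C"
  obtains d Z where "deflation \<E> d" "d \<in> Hom C X Z"
    "\<And>W u v. u \<in> Hom C W Z \<Longrightarrow> v \<in> Hom C W Z \<Longrightarrow> u = v"
proof -
  note IX = Ide_Hom[OF X]
  obtain d where "(Ide C X, d) \<in> \<E>"
    using Ide_inflation[OF X] by (auto simp: inflation_def)
  then have d: "deflation \<E> d" and cok: "is_cokernel C d (Ide C X)"
    using conflation_cokernel by (auto simp: deflation_def)
  define Z where "Z = Tgt C d"
  have dH: "d \<in> Hom C X Z" and d0: "d \<bullet> Ide C X = Zero C X Z"
    using cok Hom_D[OF IX] by (auto simp: is_cokernel_def Z_def Hom_def)
  have uniq: "g = g'" if "g \<in> Hom C Z W" "g' \<in> Hom C Z W" "g \<bullet> d = Zero C X W" "g' \<bullet> d = Zero C X W"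
    for g g' W
  proof -
    have W: "W \<in> Ob C"
      using Hom_D[OF that(1)] by simp
    then have "Zero C X W \<in> Hom C (Tgt C (Ide C X)) W"
        "Zero C X W \<bullet> Ide C X = Zero C (Src C (Ide C X)) W"
      using Zero_Hom[OF X W] Cmp_Ide Hom_D[OF IX] by auto
    then have "\<exists>!g. g \<in> Hom C Z W \<and> g \<bullet> d = Zero C X W"
      using cok W unfolding is_cokernel_def Z_def by simp
    then show ?thesis
      using that by blast
  qed
  have Z: "Z \<in> Ob C"
    using Hom_D[OF dH] by simp
  have "Ide C Z \<bullet> d = Zero C X Z" "Zero C Z Z \<bullet> d = Zero C X Z"
    using Ide_Cmp[OF dH] Zero_Cmp[OF dH Z] d0 Cmp_Ide[OF dH] by auto
  then have "Ide C Z = Zero C Z Z"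
    using uniq Ide_Hom[OF Z] Zero_Hom[OF Z Z] by blast
  then have "u = Zero C W Z" if "u \<in> Hom C W Z" for u W
    using Ide_Cmp[OF that] Zero_Cmp[OF that Z] by simp
  then show ?thesis
    using that[OF d dH] by metis
qed

text \<open>The biproduct is the pullback of \<open>X\<close> and \<open>Y\<close> over a zero
  object, so \<open>p\<close> is the base change of a deflation from \<open>Y\<close> to
  zero.\<close>

lemma deflation_projection:
  assumes bp: "biproduct C X Y S i j p q"
  shows "deflation \<E> p"
proof -
  have h: "p \<in> Hom C S X" "q \<in> Hom C S Y"
    using bp by (auto simp: biproduct_def)
  obtain d Z where d: "deflation \<E> d" "d \<in> Hom C Y Z"
      and Z: "\<And>W u v. u \<in> Hom C W Z \<Longrightarrow> v \<in> Hom C W Z \<Longrightarrow> u = v"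
    using deflation_to_zero Hom_D[OF h(2)] by metis
  have z: "Zero C X Z \<in> Hom C X Z"
    using Zero_Hom Hom_D[OF h(1)] Hom_D[OF d(2)] by blast
  have "is_pullback C d (Zero C X Z) q p"
    unfolding is_pullback_def
  proof (intro conjI ballI impI)
    show "d \<bullet> q = Zero C X Z \<bullet> p"
      using Z[OF Cmp_Hom[OF h(2) d(2)] Cmp_Hom[OF h(1) z]] .
    fix W u v assume "u \<in> Hom C W (Src C d)" "v \<in> Hom C W (Src C (Zero C X Z))"
    then have uv: "u \<in> Hom C W Y" "v \<in> Hom C W X"
      using Hom_D[OF d(2)] Hom_D[OF z] by auto
    obtain w where "w \<in> Hom C W S" "p \<bullet> w = v" "q \<bullet> w = u"
      using biproduct_pair[OF bp uv(2,1)] .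
    then show "\<exists>!w. w \<in> Hom C W (Src C p) \<and> q \<bullet> w = u \<and> p \<bullet> w = v"
      using biproduct_ext[OF bp] Hom_D[OF h(1)] by metis
  qed (use Hom_D[OF d(2)] Hom_D[OF z] Hom_D[OF h(1)] Hom_D[OF h(2)] in auto)
  then show ?thesis
    using deflation_base_change d(1) by blast
qed

text \<open>The morphism \<open>(a, d) : S \<oplus> P \<rightarrow> X\<close> factors as \<open>S \<oplus> P \<rightarrow> X \<oplus> S \<rightarrow> X\<close>, where the first
  morphism is the base change of \<open>d\<close> along \<open>u = (1, -a)\<close> and the second is the projection.\<close>

lemma deflation_copair:
  assumes bp: "biproduct C S P D i j p q"
    and a: "a \<in> Hom C S X" and d: "d \<in> Hom C P X" "deflation \<E> d"
  shows "deflation \<E> (a \<bullet> p \<^bold>+ d \<bullet> q)"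
proof -
  have h: "p \<in> Hom C D S" "q \<in> Hom C D P"
    using bp by (auto simp: biproduct_def)
  have ob: "X \<in> Ob C" "S \<in> Ob C"
    using Hom_D[OF a] by auto
  obtain T i' j' p' q' where bp': "biproduct C X S T i' j' p' q'"
    using ex_direct_sum[OF ob] unfolding direct_sum_iff_biproduct by blast
  have h': "p' \<in> Hom C T X" "q' \<in> Hom C T S"
    using bp' by (auto simp: biproduct_def)
  define m where "m = a \<bullet> p \<^bold>+ d \<bullet> q"
  have m: "m \<in> Hom C D X"
    using copair_Hom[OF bp a d(1)] by (simp add: m_def)
  note aq = Cmp_Hom[OF h'(2) a]
  obtain n where n: "n \<in> Hom C T X" "a \<bullet> q' \<^bold>+ n = Zero C T X"
    using ex_negative[OF aq] .
  \<comment> \<open>Since \<open>n\<close> is the negative of \<open>a \<bullet> q'\<close>, this is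
    \<open>p' - a \<bullet> q'\<close>.\<close>
  define u where "u = n \<^bold>+ p'"
  have u: "u \<in> Hom C T X"
    using Plus_Hom[OF n(1) h'(1)] by (simp add: u_def)
  have "a \<bullet> q' \<^bold>+ u = p'"
    using Plus_assoc[OF aq n(1) h'(1)] n(2) Zero_Plus[OF h'(1)] by (simp add: u_def)
  then have p'_eq: "a \<bullet> (q' \<bullet> w) \<^bold>+ u \<bullet> w = p' \<bullet> w" if w: "w \<in> Hom C W T" for w W
    using Cmp_Plus_left[OF w aq u] Cmp_assoc[OF w h'(2) a] by simp
  have m_eq: "a \<bullet> (p \<bullet> w) \<^bold>+ d \<bullet> (q \<bullet> w) = m \<bullet> w" if w: "w \<in> Hom C W D" for w W
    using copair_Cmp[OF bp a d(1) w] by (simp add: m_def)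
  obtain r where r: "r \<in> Hom C D T" "p' \<bullet> r = m" "q' \<bullet> r = p"
    using biproduct_pair[OF bp' m h(1)] .
  have "is_pullback C d u q r"
    unfolding is_pullback_def
  proof (intro conjI ballI impI)
    have "a \<bullet> p \<^bold>+ d \<bullet> q = a \<bullet> p \<^bold>+ u \<bullet> r"
      using p'_eq[OF r(1)] r by (simp add: m_def)
    then show "d \<bullet> q = u \<bullet> r"
      using Plus_left_cancel[OF Cmp_Hom[OF h(1) a] Cmp_Hom[OF h(2) d(1)] Cmp_Hom[OF r(1) u]] by blast
    fix W x y assume "x \<in> Hom C W (Src C d)" "y \<in> Hom C W (Src C u)" and eq: "d \<bullet> x = u \<bullet> y"
    then have x: "x \<in> Hom C W P" and y: "y \<in> Hom C W T"
      using Hom_D[OF d(1)] Hom_D[OF u] by auto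
    \<comment> \<open>The \<open>P\<close>-component of \<open>w\<close> must be \<open>x\<close>;
      its \<open>S\<close>-component is forced by \<open>q' \<bullet> r = p\<close> to be that of
      \<open>y\<close>.\<close>
    obtain w where w: "w \<in> Hom C W D" "p \<bullet> w = q' \<bullet> y" "q \<bullet> w = x"
      using biproduct_pair[OF bp Cmp_Hom[OF y h'(2)] x] .
    have rw: "r \<bullet> w = y"
    proof (rule biproduct_ext[OF bp' Cmp_Hom[OF w(1) r(1)] y])
      show "p' \<bullet> (r \<bullet> w) = p' \<bullet> y"
        using Cmp_assoc[OF w(1) r(1) h'(1)] r(2) m_eq[OF w(1)] w eq p'_eq[OF y] by simp
      show "q' \<bullet> (r \<bullet> w) = q' \<bullet> y"
        using Cmp_assoc[OF w(1) r(1) h'(2)] r(3) w(2) by simp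
    qed
    show "\<exists>!w. w \<in> Hom C W (Src C r) \<and> q \<bullet> w = x \<and> r \<bullet> w = y"
    proof (intro ex1I conjI)
      fix v assume "v \<in> Hom C W (Src C r) \<and> q \<bullet> v = x \<and> r \<bullet> v = y"
      then have v: "v \<in> Hom C W D" "q \<bullet> v = x" "r \<bullet> v = y"
        using Hom_D[OF r(1)] by auto
      have "p \<bullet> v = q' \<bullet> y"
        using Cmp_assoc[OF v(1) r(1) h'(2)] r(3) v(3) by simp
      then show "v = w"
        using biproduct_ext[OF bp v(1) w(1)] v w by simp
    qed (use w rw Hom_D[OF r(1)] in auto)
  qed (use Hom_D[OF d(1)] Hom_D[OF u] Hom_D[OF r(1)] Hom_D[OF h(2)] in auto)
  then have "deflation \<E> r"
    using deflation_base_change d(2) by blast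
  then have "deflation \<E> (p' \<bullet> r)"
    using Cmp_deflation deflation_projection[OF bp'] Hom_D[OF r(1)] Hom_D[OF h'(1)] by metis
  then show ?thesis
    using r(2) by (simp add: m_def)
qed

end

section \<open>Right acyclic conflations\<close>

text \<open>The part of Hom-exactness not supplied by the kernel. It mentions the deflation only,
  and with a singleton for \<S> it also expresses projectivity of one object.\<close>

definition lifts :: "('o, 'm, 'z) precategory_scheme \<Rightarrow> 'o set \<Rightarrow> 'm \<Rightarrow> bool" where
  "lifts C \<S> d \<longleftrightarrow> (\<forall>T\<in>\<S>. \<forall>g\<in>Hom C T (Tgt C d). \<exists>h\<in>Hom C T (Src C d). d \<bullet>\<^bsub>C\<^esub> h = g)"

lemma liftsE:
  assumes "lifts C \<S> d" "T \<in> \<S>" "d \<in> Hom C X Y" "g \<in> Hom C T Y"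
  obtains h where "h \<in> Hom C T X" "d \<bullet>\<^bsub>C\<^esub> h = g"
  using assms by (auto simp: lifts_def Hom_def)

context exact_category
begin

lemma right_acyclic_iff:
  assumes "\<S> \<subseteq> Ob C"
  shows "(i, d) \<in> right_acyclic C \<E> \<S> \<longleftrightarrow> (i, d) \<in> \<E> \<and> lifts C \<S> d"
  using assms Hom_from_exact_iff[OF conflation_kernel]
  by (auto simp: right_acyclic_def lifts_def subset_iff)

text \<open>As the lifting condition does not involve the kernel, every inflation that completes
  \<open>d\<close> to a conflation in \<E> also completes it to an acyclic one.\<close>

lemma deflation_right_acyclic_iff:
  assumes "\<S> \<subseteq> Ob C"
  shows "deflation (right_acyclic C \<E> \<S>) d \<longleftrightarrow> deflation \<E> d \<and> lifts C \<S> d"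
  using right_acyclic_iff[OF assms] by (auto simp: deflation_def)

text \<open>Only kernels of the conflations are used, and these come from \<E>; so \<F> may be any
  subclass, whether or not it is an exact structure.\<close>

lemma projectives_iff:
  assumes "\<F> \<subseteq> \<E>"
  shows "P \<in> projectives C \<F> \<longleftrightarrow> P \<in> Ob C \<and> (\<forall>d. deflation \<F> d \<longrightarrow> lifts C {P} d)"
proof (cases "P \<in> Ob C")
  case True
  have "Hom_from_exact C P (i, d) \<longleftrightarrow> lifts C {P} d" if "(i, d) \<in> \<F>" for i d
    using Hom_from_exact_iff[OF conflation_kernel True] that assms by (auto simp: lifts_def)
  then show ?thesis
    using True by (auto simp: projectives_def deflation_def)
qed (simp add: projectives_def)

lemma projectives_lift:
  assumes "\<F> \<subseteq> \<E>" "P \<in> projectives C \<F>" "deflation \<F> d" "d \<in> Hom C X Y" "g \<in> Hom C P Y"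
  obtains h where "h \<in> Hom C P X" "d \<bullet> h = g"
proof -
  have "lifts C {P} d"
    using assms projectives_iff[OF assms(1)] by simp
  from liftsE[OF this _ assms(4,5)] that show ?thesis
    by blast
qed

section \<open>Projectives form an additive subcategory closed under summands\<close>

lemma zero_object_projective:
  assumes \<F>: "\<F> \<subseteq> \<E>" and Z: "zero_object C Z"
  shows "Z \<in> projectives C \<F>"
proof -
  have "lifts C {Z} d" if "deflation \<F> d" for d
  proof -
    have "deflation \<E> d"
      using that \<F> by (auto simp: deflation_def)
    then have d: "d \<in> Hom C (Src C d) (Tgt C d)"
      by (intro Hom_I deflation_Arr)
    have "\<exists>h\<in>Hom C Z (Src C d). d \<bullet> h = g" if g: "g \<in> Hom C Z (Tgt C d)" for g
    proof -
      obtain h where h: "h \<in> Hom C Z (Src C d)"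
        using Z Hom_D[OF d] by (auto simp: zero_object_def)
      have "\<exists>!f. f \<in> Hom C Z (Tgt C d)"
        using Z Hom_D[OF d] by (simp add: zero_object_def)
      then show ?thesis
        using h g Cmp_Hom[OF h d] by blast
    qed
    then show ?thesis
      by (simp add: lifts_def)
  qed
  then show ?thesis
    using Z projectives_iff[OF \<F>] by (simp add: zero_object_def)
qed

lemma direct_sum_projective:
  assumes \<F>: "\<F> \<subseteq> \<E>" and P: "P \<in> projectives C \<F>" and Q: "Q \<in> projectives C \<F>"
    and D: "direct_sum C P Q D"
  shows "D \<in> projectives C \<F>"
proof -
  obtain i j p q where bp: "biproduct C P Q D i j p q"
    using D unfolding direct_sum_iff_biproduct by blast
  then have h: "i \<in> Hom C P D" "j \<in> Hom C Q D"
    by (auto simp: biproduct_def)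
  have "lifts C {D} d" if d: "deflation \<F> d" for d
  proof -
    have "deflation \<E> d"
      using that \<F> by (auto simp: deflation_def)
    then have dH: "d \<in> Hom C (Src C d) (Tgt C d)"
      by (intro Hom_I deflation_Arr)
    have "\<exists>h\<in>Hom C D (Src C d). d \<bullet> h = g" if g: "g \<in> Hom C D (Tgt C d)" for g
    proof -
      obtain a where a: "a \<in> Hom C P (Src C d)" "d \<bullet> a = g \<bullet> i"
        using projectives_lift[OF \<F> P d dH Cmp_Hom[OF h(1) g]] .
      obtain b where b: "b \<in> Hom C Q (Src C d)" "d \<bullet> b = g \<bullet> j"
        using projectives_lift[OF \<F> Q d dH Cmp_Hom[OF h(2) g]] .
      have pq: "p \<in> Hom C D P" "q \<in> Hom C D Q"
        using bp by (auto simp: biproduct_def)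
      have "d \<bullet> (a \<bullet> p \<^bold>+ b \<bullet> q) = (g \<bullet> i) \<bullet> p \<^bold>+ (g \<bullet> j) \<bullet> q"
        using Cmp_Plus_right[OF Cmp_Hom[OF pq(1) a(1)] Cmp_Hom[OF pq(2) b(1)] dH] a(2) b(2)
          Cmp_assoc[OF pq(1) a(1) dH] Cmp_assoc[OF pq(2) b(1) dH] by simp
      also have "\<dots> = g \<bullet> (i \<bullet> p \<^bold>+ j \<bullet> q)"
        using Cmp_Plus_right[OF Cmp_Hom[OF pq(1) h(1)] Cmp_Hom[OF pq(2) h(2)] g]
          Cmp_assoc[OF pq(1) h(1) g] Cmp_assoc[OF pq(2) h(2) g] by simp
      also have "\<dots> = g"
        using bp Cmp_Ide[OF g] by (simp add: biproduct_def)
      finally show ?thesis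
        using copair_Hom[OF bp a(1) b(1)] by blast
    qed
    then show ?thesis
      by (simp add: lifts_def)
  qed
  then show ?thesis
    using projectives_iff[OF \<F>] Hom_D[OF h(1)] by simp
qed

lemma direct_summand_projective:
  assumes \<F>: "\<F> \<subseteq> \<E>" and D: "direct_sum C X Y D" "D \<in> projectives C \<F>"
  shows "X \<in> projectives C \<F>"
proof -
  obtain i p where ip: "i \<in> Hom C X D" "p \<in> Hom C D X" "p \<bullet> i = Ide C X"
    using D(1) unfolding direct_sum_def by blast
  have "lifts C {X} d" if d: "deflation \<F> d" for d
  proof -
    have "deflation \<E> d"
      using that \<F> by (auto simp: deflation_def)
    then have dH: "d \<in> Hom C (Src C d) (Tgt C d)"
      by (intro Hom_I deflation_Arr)
    have "\<exists>h\<in>Hom C X (Src C d). d \<bullet> h = g" if g: "g \<in> Hom C X (Tgt C d)" for g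
    proof -
      \<comment> \<open>Extend \<open>g\<close> to \<open>D\<close> along the projection, lift
        there, and restrict the lift to \<open>X\<close> along \<open>i\<close>.\<close>
      obtain h where h: "h \<in> Hom C D (Src C d)" "d \<bullet> h = g \<bullet> p"
        using projectives_lift[OF \<F> D(2) d dH Cmp_Hom[OF ip(2) g]] .
      have "d \<bullet> (h \<bullet> i) = g"
        using Cmp_assoc[OF ip(1) h(1) dH] h(2) Cmp_assoc[OF ip(1,2) g] ip(3) Cmp_Ide[OF g] by simp
      then show ?thesis
        using Cmp_Hom[OF ip(1) h(1)] by blast
    qed
    then show ?thesis
      by (simp add: lifts_def)
  qed
  then show ?thesis
    using projectives_iff[OF \<F>] Hom_D[OF ip(1)] by simp
qed

lemma additive_subcategory_projectives:
  assumes "\<F> \<subseteq> \<E>"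
  shows "additive_subcategory C (projectives C \<F>)"
proof -
  have "projectives C \<F> \<subseteq> Ob C"
    by (auto simp: projectives_def)
  then show ?thesis
    using ex_zero_object zero_object_projective[OF assms] ex_direct_sum
      direct_sum_projective[OF assms] unfolding additive_subcategory_def by blast
qed

lemma summand_closed_projectives: "\<F> \<subseteq> \<E> \<Longrightarrow> summand_closed C (projectives C \<F>)"
  using direct_summand_projective unfolding summand_closed_def by blast

lemma projectives_antimono: "\<F> \<subseteq> \<E> \<Longrightarrow> projectives C \<E> \<subseteq> projectives C \<F>"
  by (auto simp: projectives_def)

section \<open>Projectives relative to the right acyclic conflations\<close>

lemma subset_projectives_right_acyclic:
  "\<S> \<subseteq> Ob C \<Longrightarrow> \<S> \<subseteq> projectives C (right_acyclic C \<E> \<S>)"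
  by (auto simp: projectives_def right_acyclic_def)

lemma right_acyclic_subset: "right_acyclic C \<E> \<S> \<subseteq> \<E>"
  by (auto simp: right_acyclic_def)

text \<open>The objects \<open>S\<close> and \<open>P\<close> are fixed before \<open>D\<close>, and
  every direct sum \<open>D\<close> is allowed: one application takes any \<open>D\<close>, another
  needs \<open>D\<close> in a prescribed subcategory. Lifting works because \<open>m\<close>
  restricts to the approximation on the summand \<open>S\<close>.\<close>

lemma right_acyclic_cover:
  assumes proj: "enough_projectives C \<E>" and fin: "contravariantly_finite C \<S>" and X: "X \<in> Ob C"
  obtains S P where "S \<in> \<S>" "P \<in> projectives C \<E>"
    "\<And>D. direct_sum C S P D \<Longrightarrow> \<exists>m\<in>Hom C D X. deflation (right_acyclic C \<E> \<S>) m"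
proof -
  have sub: "\<S> \<subseteq> Ob C"
    using fin by (simp add: contravariantly_finite_def additive_subcategory_def)
  obtain a where "right_approximation C \<S> X a"
    using fin X by (auto simp: contravariantly_finite_def)
  then obtain S where S: "S \<in> \<S>" "a \<in> Hom C S X"
      and a: "\<And>T g. T \<in> \<S> \<Longrightarrow> g \<in> Hom C T X \<Longrightarrow> \<exists>h\<in>Hom C T S. g = a \<bullet> h"
    by (auto simp: right_approximation_def Hom_def)
  obtain P d where P: "P \<in> projectives C \<E>" "d \<in> Hom C P X" "deflation \<E> d"
    using proj X by (auto simp: enough_projectives_def)
  have "\<exists>m\<in>Hom C D X. deflation (right_acyclic C \<E> \<S>) m" if D: "direct_sum C S P D" for D
  proof -
    obtain i j p q where bp: "biproduct C S P D i j p q"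
      using D unfolding direct_sum_iff_biproduct by blast
    define m where "m = a \<bullet> p \<^bold>+ d \<bullet> q"
    have m: "m \<in> Hom C D X" "deflation \<E> m" "m \<bullet> i = a"
      using copair_Hom[OF bp S(2) P(2)] deflation_copair[OF bp S(2) P(2,3)]
        copair_inl[OF bp S(2) P(2)] by (simp_all add: m_def)
    have i: "i \<in> Hom C S D"
      using bp by (simp add: biproduct_def)
    have "\<exists>h\<in>Hom C T D. m \<bullet> h = g" if T: "T \<in> \<S>" and g: "g \<in> Hom C T X" for T g
    proof -
      obtain h where h: "h \<in> Hom C T S" "g = a \<bullet> h"
        using a[OF T g] by blast
      then have "m \<bullet> (i \<bullet> h) = g"
        using Cmp_assoc[OF h(1) i m(1)] m(3) by simp
      then show ?thesis
        using Cmp_Hom[OF h(1) i] by blast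
    qed
    then have "lifts C \<S> m"
      using Hom_D[OF m(1)] by (simp add: lifts_def)
    then show ?thesis
      using m deflation_right_acyclic_iff[OF sub] by blast
  qed
  then show ?thesis
    using that S(1) P(1) by blast
qed

lemma enough_projectives_right_acyclic:
  assumes proj: "enough_projectives C \<E>" and fin: "contravariantly_finite C \<S>"
  shows "enough_projectives C (right_acyclic C \<E> \<S>)"
  unfolding enough_projectives_def
proof
  fix X assume "X \<in> Ob C"
  then obtain S P where S: "S \<in> \<S>" and P: "P \<in> projectives C \<E>"
      and cover: "\<And>D. direct_sum C S P D \<Longrightarrow> \<exists>m\<in>Hom C D X. deflation (right_acyclic C \<E> \<S>) m"
    using right_acyclic_cover[OF proj fin] by metis
  have sub: "\<S> \<subseteq> Ob C"
    using fin by (simp add: contravariantly_finite_def additive_subcategory_def)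
  \<comment> \<open>\<open>S\<close> is projective by the very definition of acyclicity, and
    \<open>P\<close> because there are fewer conflations to test.\<close>
  have SP: "S \<in> projectives C (right_acyclic C \<E> \<S>)" "P \<in> projectives C (right_acyclic C \<E> \<S>)"
    using S P subset_projectives_right_acyclic[OF sub] projectives_antimono[OF right_acyclic_subset]
    by auto
  obtain D where D: "direct_sum C S P D"
    using ex_direct_sum[of S P] SP by (auto simp: projectives_def)
  show "\<exists>P\<in>projectives C (right_acyclic C \<E> \<S>).
      \<exists>d\<in>Hom C P X. deflation (right_acyclic C \<E> \<S>) d"
    using cover[OF D] direct_sum_projective[OF right_acyclic_subset SP D] by blast
qed

lemma projectives_right_acyclic:
  assumes proj: "enough_projectives C \<E>" and fin: "contravariantly_finite C \<S>"
  shows "projectives C (right_acyclic C \<E> \<S>) = subcategory_join C \<S> (projectives C \<E>)"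
proof (intro subset_antisym)
  have sub: "\<S> \<subseteq> Ob C"
    using fin by (simp add: contravariantly_finite_def additive_subcategory_def)
  \<comment> \<open>The relative projectives are themselves one of the subcategories intersected in
    the join.\<close>
  show "subcategory_join C \<S> (projectives C \<E>) \<subseteq> projectives C (right_acyclic C \<E> \<S>)"
    unfolding subcategory_join_def
    using additive_subcategory_projectives[OF right_acyclic_subset]
      summand_closed_projectives[OF right_acyclic_subset] subset_projectives_right_acyclic[OF sub]
      projectives_antimono[OF right_acyclic_subset] by (intro Inter_lower) blast
  show "projectives C (right_acyclic C \<E> \<S>) \<subseteq> subcategory_join C \<S> (projectives C \<E>)"
    unfolding subcategory_join_def
  proof (intro subsetI InterI)
    fix X \<T> assume X: "X \<in> projectives C (right_acyclic C \<E> \<S>)"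
      and "\<T> \<in> {\<T>. additive_subcategory C \<T> \<and> summand_closed C \<T> \<and> \<S> \<subseteq> \<T>
        \<and> projectives C \<E> \<subseteq> \<T>}"
    then have \<T>: "additive_subcategory C \<T>" "summand_closed C \<T>" "\<S> \<subseteq> \<T>" "projectives C \<E> \<subseteq> \<T>"
      by auto
    have XO: "X \<in> Ob C"
      using X by (simp add: projectives_def)
    then obtain S P where S: "S \<in> \<S>" and P: "P \<in> projectives C \<E>"
        and cover: "\<And>D. direct_sum C S P D \<Longrightarrow> \<exists>m\<in>Hom C D X. deflation (right_acyclic C \<E> \<S>) m"
      using right_acyclic_cover[OF proj fin] by metis
    \<comment> \<open>The direct sum is the one that additivity of \<T> provides, which places the
      source of the cover in \<T>.\<close>
    then obtain D where D: "D \<in> \<T>" "direct_sum C S P D"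
      using \<T> unfolding additive_subcategory_def by blast
    obtain m where m: "m \<in> Hom C D X" "deflation (right_acyclic C \<E> \<S>) m"
      using cover[OF D(2)] by blast
    then obtain k where k: "is_kernel C k m"
      using right_acyclic_subset conflation_kernel unfolding deflation_def by blast
    \<comment> \<open>\<open>X\<close> is projective for exactly the class in which \<open>m\<close>
      is a deflation, so its identity lifts and \<open>m\<close> splits.\<close>
    obtain s where "s \<in> Hom C X D" "m \<bullet> s = Ide C X"
      using projectives_lift[OF right_acyclic_subset X m(2,1) Ide_Hom[OF XO]] .
    then have "direct_sum C X (Src C k) D"
      using split_epi_direct_sum[OF k m(1)] by blast
    then show "X \<in> \<T>"
      using \<T>(2) D(1) unfolding summand_closed_def by blast
  qed
qed

section \<open>The exact structure given by acyclic conflations\<close>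

lemma Ide_deflation_right_acyclic:
  assumes "\<S> \<subseteq> Ob C" "X \<in> Ob C"
  shows "deflation (right_acyclic C \<E> \<S>) (Ide C X)"
proof -
  have "lifts C \<S> (Ide C X)"
    using Hom_D[OF Ide_Hom[OF assms(2)]] Ide_Cmp by (auto simp: lifts_def)
  then show ?thesis
    using deflation_right_acyclic_iff[OF assms(1)] Ide_deflation[OF assms(2)] by simp
qed

lemma Cmp_deflation_right_acyclic:
  assumes \<S>: "\<S> \<subseteq> Ob C" and f: "deflation (right_acyclic C \<E> \<S>) f"
    and g: "deflation (right_acyclic C \<E> \<S>) g" and fg: "Tgt C f = Src C g"
  shows "deflation (right_acyclic C \<E> \<S>) (g \<bullet> f)"
proof -
  have f': "deflation \<E> f" "lifts C \<S> f" and g': "deflation \<E> g" "lifts C \<S> g"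
    using f g deflation_right_acyclic_iff[OF \<S>] by auto
  have fH: "f \<in> Hom C (Src C f) (Src C g)" and gH: "g \<in> Hom C (Src C g) (Tgt C g)"
    using Hom_I[OF deflation_Arr[OF f'(1)]] Hom_I[OF deflation_Arr[OF g'(1)]] fg by auto
  have "\<exists>h\<in>Hom C T (Src C f). (g \<bullet> f) \<bullet> h = u" if T: "T \<in> \<S>" and u: "u \<in> Hom C T (Tgt C g)" for T u
  proof -
    obtain v where v: "v \<in> Hom C T (Src C g)" "g \<bullet> v = u"
      using liftsE[OF g'(2) T gH u] .
    obtain w where w: "w \<in> Hom C T (Src C f)" "f \<bullet> w = v"
      using liftsE[OF f'(2) T fH v(1)] .
    then show ?thesis
      using Cmp_assoc[OF w(1) fH gH] v(2) by auto
  qed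
  then have "lifts C \<S> (g \<bullet> f)"
    using Hom_D[OF Cmp_Hom[OF fH gH]] by (simp add: lifts_def)
  then show ?thesis
    using deflation_right_acyclic_iff[OF \<S>] Cmp_deflation[OF f'(1) g'(1) fg] by simp
qed

lemma pullback_deflation_right_acyclic:
  assumes \<S>: "\<S> \<subseteq> Ob C" and d: "deflation (right_acyclic C \<E> \<S>) d"
    and f: "f \<in> Arr C" "Tgt C f = Tgt C d"
  shows "\<exists>f' d'. is_pullback C d f f' d' \<and> deflation (right_acyclic C \<E> \<S>) d'"
proof -
  have d': "deflation \<E> d" "lifts C \<S> d"
    using d deflation_right_acyclic_iff[OF \<S>] by auto
  obtain f' d' where pb: "is_pullback C d f f' d'" and "deflation \<E> d'"
    using pullback_deflation[OF d'(1) f] by blast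
  have dH: "d \<in> Hom C (Src C d) (Tgt C d)" and fH: "f \<in> Hom C (Src C f) (Tgt C d)"
    using Hom_I[OF deflation_Arr[OF d'(1)]] Hom_I[OF f(1)] f(2) by auto
  have "\<exists>w\<in>Hom C T (Src C d'). d' \<bullet> w = g" if T: "T \<in> \<S>" and g: "g \<in> Hom C T (Src C f)" for T g
  proof -
    \<comment> \<open>A lift of \<open>f \<bullet> g\<close> along \<open>d\<close> forms a cone
      together with \<open>g\<close>; the induced morphism into the pullback is the required lift of
      \<open>g\<close>.\<close>
    obtain u where u: "u \<in> Hom C T (Src C d)" "d \<bullet> u = f \<bullet> g"
      using liftsE[OF d'(2) T dH Cmp_Hom[OF g fH]] .
    then have "\<exists>!w. w \<in> Hom C T (Src C d') \<and> f' \<bullet> w = u \<and> d' \<bullet> w = g"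
      using pb g T \<S> unfolding is_pullback_def by blast
    then show ?thesis
      by blast
  qed
  then have "lifts C \<S> d'"
    using pb by (simp add: lifts_def is_pullback_def)
  then show ?thesis
    using pb \<open>deflation \<E> d'\<close> deflation_right_acyclic_iff[OF \<S>] by blast
qed

text \<open>Lifting passes through the right-hand square alone: carry \<open>g\<close> back along
  the inverse of \<open>c\<close>, lift along \<open>d\<close>, and push the result forward by
  \<open>b\<close>.\<close>

lemma iso_right_acyclic:
  assumes \<S>: "\<S> \<subseteq> Ob C" and id: "(i, d) \<in> right_acyclic C \<E> \<S>" and id': "(i', d') \<in> \<E>"
    and b: "b \<in> Hom C (Tgt C i) (Tgt C i')"
    and c: "iso_arrow C c" "c \<in> Hom C (Tgt C d) (Tgt C d')" and sq: "c \<bullet> d = d' \<bullet> b"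
  shows "(i', d') \<in> right_acyclic C \<E> \<S>"
proof -
  have d: "(i, d) \<in> \<E>" "lifts C \<S> d"
    using id right_acyclic_iff[OF \<S>] by auto
  obtain e where e: "e \<in> Hom C (Tgt C d') (Tgt C d)" "c \<bullet> e = Ide C (Tgt C d')"
    using iso_arrow_inverse[OF c] by metis
  note dH = conflation_Hom(2)[OF d(1)] and dH' = conflation_Hom(2)[OF id']
  have "\<exists>h\<in>Hom C T (Tgt C i'). d' \<bullet> h = g" if T: "T \<in> \<S>" and g: "g \<in> Hom C T (Tgt C d')" for T g
  proof -
    obtain h where h: "h \<in> Hom C T (Tgt C i)" "d \<bullet> h = e \<bullet> g"
      using liftsE[OF d(2) T dH Cmp_Hom[OF g e(1)]] .
    have "d' \<bullet> (b \<bullet> h) = c \<bullet> (d \<bullet> h)"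
      using Cmp_assoc[OF h(1) b dH'] Cmp_assoc[OF h(1) dH c(2)] sq by simp
    also have "\<dots> = g"
      using h(2) Cmp_assoc[OF g e(1) c(2)] e(2) Ide_Cmp[OF g] by simp
    finally show ?thesis
      using Cmp_Hom[OF h(1) b] by blast
  qed
  then have "lifts C \<S> d'"
    using conflation_Hom(3)[OF id'] by (simp add: lifts_def)
  then show ?thesis
    using id' right_acyclic_iff[OF \<S>] by simp
qed

lemma exact_category_right_left_acyclic:
  assumes \<S>: "\<S> \<subseteq> Ob C" and \<T>: "\<T> \<subseteq> Ob C"
    and eq: "right_acyclic C \<E> \<S> = left_acyclic C \<E> \<T>"
  shows "exact_category C (right_acyclic C \<E> \<S>)"
proof -
  interpret op: exact_category "opposite C" "\<E>\<inverse>"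
    by (rule exact_category_opposite)
  let ?\<F> = "right_acyclic C \<E> \<S>"
  \<comment> \<open>The equality of the two classes makes the converse of \<open>?\<F>\<close> a
    class of right acyclic conflations in the opposite category, so the inflation axioms become
    deflation axioms already proved there.\<close>
  have op_eq: "right_acyclic (opposite C) (\<E>\<inverse>) \<T> = ?\<F>\<inverse>"
    using right_acyclic_opposite eq by simp
  have \<T>': "\<T> \<subseteq> Ob (opposite C)"
    using \<T> by simp
  show ?thesis
  proof (intro exact_category.intro exact_category_axioms.intro)
    show "additive_category C" ..
    show "(i', d') \<in> ?\<F>"
      if "(i, d) \<in> ?\<F>" "i' \<in> Arr C" "d' \<in> Arr C" "Tgt C i' = Src C d'"
        "iso_arrow C a" "a \<in> Hom C (Src C i) (Src C i')"
        "iso_arrow C b" "b \<in> Hom C (Tgt C i) (Tgt C i')"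
        "iso_arrow C c" "c \<in> Hom C (Tgt C d) (Tgt C d')"
        "b \<bullet> i = i' \<bullet> a" "c \<bullet> d = d' \<bullet> b" for i d i' d' a b c
      using iso_right_acyclic[OF \<S> that(1) _ that(8,9,10,12)] conflation_iso[OF _ that(2-12)]
        that(1) right_acyclic_subset by blast
    show "is_kernel C i d" "is_cokernel C d i" if "(i, d) \<in> ?\<F>" for i d
      using that right_acyclic_subset conflation_kernel conflation_cokernel by blast+
    show "inflation ?\<F> (Ide C X)" if "X \<in> Ob C" for X
      using op.Ide_deflation_right_acyclic[OF \<T>', unfolded op_eq] that by simp
    \<comment> \<open>Composition is reversed in the opposite category, hence the swapped
      instantiation.\<close>
    show "inflation ?\<F> (g \<bullet> f)" if "inflation ?\<F> f" "inflation ?\<F> g" "Tgt C f = Src C g" for f g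
      using op.Cmp_deflation_right_acyclic[OF \<T>', unfolded op_eq, of g f] that by simp
    show "\<exists>f' i'. is_pushout C i f f' i' \<and> inflation ?\<F> i'"
      if "inflation ?\<F> i" "f \<in> Arr C" "Src C f = Src C i" for i f
      using op.pullback_deflation_right_acyclic[OF \<T>', unfolded op_eq, of i f] that by simp
  qed (use Ide_deflation_right_acyclic Cmp_deflation_right_acyclic
      pullback_deflation_right_acyclic \<S> in auto)
qed

text \<open>Both claims are the projective ones read in the opposite category; the join keeps its
  meaning there because zero objects and direct sums are self-dual.\<close>

lemma
  assumes inj: "enough_injectives C \<E>" and fin: "covariantly_finite C \<T>"
  shows injectives_left_acyclic:
      "injectives C (left_acyclic C \<E> \<T>) = subcategory_join C \<T> (injectives C \<E>)" (is ?join)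
    and enough_injectives_left_acyclic: "enough_injectives C (left_acyclic C \<E> \<T>)" (is ?enough)
proof -
  interpret op: exact_category "opposite C" "\<E>\<inverse>"
    by (rule exact_category_opposite)
  have sub: "left_acyclic C \<E> \<T> \<subseteq> \<E>"
    by (auto simp: left_acyclic_def)
  have "enough_projectives (opposite C) (\<E>\<inverse>)" "contravariantly_finite (opposite C) \<T>"
    using inj fin by (simp_all add: enough_projectives_opposite)
  from op.projectives_right_acyclic[OF this] op.enough_projectives_right_acyclic[OF this]
  show ?join ?enough
    by (simp_all add: right_acyclic_opposite projectives_opposite enough_projectives_opposite sub)
qed

end

theorem theorem5p1:
  fixes A :: "('o, 'm, 'z) precategory_scheme"
    and \<E> \<E>' :: "('m \<times> 'm) set"
    and \<P>' \<I>' :: "'o set"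
  assumes "exact_category A \<E>"
    and "enough_projectives A \<E>" and "enough_injectives A \<E>"
    and "additive_subcategory A \<P>'" and "\<P>' \<subseteq> projectives A \<E>"
    and "additive_subcategory A \<I>'" and "\<I>' \<subseteq> injectives A \<E>"
    and "subcategory_join A \<P>' (injectives A \<E>) = subcategory_join A \<I>' (projectives A \<E>)"
    and "covariantly_finite A \<P>'" and "contravariantly_finite A \<I>'"
    and "\<E>' = right_acyclic A \<E> \<I>'" and "\<E>' = left_acyclic A \<E> \<P>'"
  shows "frobenius_category A \<E>'"
proof -
  interpret exact_category A \<E> by fact
  have "\<P>' \<subseteq> Ob A" "\<I>' \<subseteq> Ob A"
    using assms(4,6) by (auto simp: additive_subcategory_def)
  then have "exact_category A \<E>'"
    using exact_category_right_left_acyclic assms(11,12) by metis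
  \<comment> \<open>Each description of \<E>' governs one side: right acyclicity the projectives,
    left acyclicity the injectives. The two joins obtained are the two sides of the assumed
    equality.\<close>
  moreover have "enough_projectives A \<E>'" "projectives A \<E>' = subcategory_join A \<I>' (projectives A \<E>)"
    using enough_projectives_right_acyclic projectives_right_acyclic assms(2,10,11) by auto
  moreover have "enough_injectives A \<E>'" "injectives A \<E>' = subcategory_join A \<P>' (injectives A \<E>)"
    using enough_injectives_left_acyclic injectives_left_acyclic assms(3,9,12) by auto
  ultimately show ?thesis
    using assms(8) by (simp add: frobenius_category_def frobenius_category_axioms_def)
qed

end
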